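(* Consider the $(T+1)$-stage electricity market model described in the context, with continuum cost functions $\widetilde C,\widetilde H_0,\widetilde H$, and suppose that the following hold. (Scaling.) For every $n\in\mathbb N$, the cost functions of the $n$-consumer model are, for all $s\in\mathcal S$ and $\overline s\in\mathcal S^2$, $$C^n(A,s)=n\widetilde C\left(\tfrac{A}{n},s\right),\quad H^n_0(A,s)=n\widetilde H_0\left(\tfrac{A}{n},s\right),\quad H^n(A,A',\overline s)=n\widetilde H\left(\tfrac{A}{n},\tfrac{A'}{n},\overline s\right).$$ (Regularity 1.) The derivatives below exist on $[0,\infty)$ (right derivatives at $0$), and the four families of functions of $A$, $\{\widetilde C'(A,s): s\in\mathcal S\}$, $\{\widetilde H_0'(A,s): s\in\mathcal S\}$, $\{\partial \widetilde H(A,A',\overline s)/\partial A: (A',\overline s)\in\mathcal A\times\mathcal S^2\}$ and $\{\partial\widetilde H(A',A,\overline s)/\partial A: (A',\overline s)\in\mathcal A\times\mathcal S^2\}$, are uniformly equicontinuous on $[0,\infty)$. (Regularity 2.) There is a constant $P>0$ such that $|\widetilde C'(A,s)|\le P$ and $|\widetilde H_0'(A,s)|\le P$ for all $(A,s)\in\mathcal A\times\mathcal S$, and $\left|\partial\widetilde H(A,A',\overline s)/\partial A\right|\le P$ and $\left|\partial\widetilde H(A',A,\overline s)/\partial A\right|\le P$ for all $A\in\mathcal A$ and $(A',\overline s)\in\mathcal A\times\mathcal S^2$. (Regularity 3.) The utility functions $U_t(x,s,a)$, $t=0,\dots,T$, are continuous in $a$, and there is a constant $Q>0$ such that $U_t(x,s,a)\le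 Q$ for all $t=0,\dots,T$ and all $(x,s,a)\in\mathcal X_t\times\mathcal S\times\mathcal A$. Then every Dynamic Oblivious Equilibrium $\nu$ of the continuum model has the asymptotic Markov equilibrium (AME) property: for every initial global state $s_0\in\mathcal S$, every initial consumer state $x_{i,0}\in\mathcal X_0$, and every sequence $\{\kappa^n\}$ of history-dependent strategies ($\kappa^n\in\mathfrak K_n$), $$\limsup_{n\to\infty}\left(V^n_{i,0}(x_{i,0},s_0\mid\kappa^n,\nu)-V^n_{i,0}(x_{i,0},s_0\mid\nu,\nu)\right)\le 0 .$$
   Context: **Model primitives.** Time periods are $t=0,1,\dots,T$. The exogenous state $s_t$ takes values in a finite set $\mathcal S$ and evolves as a Markov chain whose transitions are not affected by consumer actions. Let $\overline s_t=(s_{t-1},s_t)$ for $t\ge1$ and $\overline s_0=s_0$ (the global state). Histories are $h_t=(s_0,\dots,s_t)\in\mathcal H_t=\mathcal S^{t+1}$. Each consumer's action set is $\mathcal A=[0,B]$ with $B>0$. Consumer types lie in a finite set $\mathcal X_0$; for each $s_0\in\mathcal S$, $\eta_{s_0}$ is a probability measure on $\mathcal X_0$. The state of consumer $i$ at stage $0$ is her type $x_{i,0}\in\mathcal X_0$; at stage $t\ge1$ it is $x_{i,t}=(x_{i,0},z_{i,t})\in\mathcal X_t=\mathcal X_0\times\mathcal Z$, with $\mathcal Z=[0,Z]$ a compact subset of $\mathbb R$, and evolves by $z_{i,t+1}=r(x_{i,t},a_{i,t},s_{t+1})\in\mathcal Z$ for a given function $r$, where $a_{i,t}\in\mathcal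 A$ is consumer $i$'s action at stage $t$. At stage $t$ consumer $i$ receives utility $U_t(x_{i,t},s_t,a_{i,t})\in[0,\infty)$. The augmented state is $y_{i,0}=x_{i,0}$ and $y_{i,t}=(a_{i,t-1},x_{i,t})$ for $t\ge1$. **Cost functions.** In the continuum model: a primary cost $\widetilde C:\mathbb R\times\mathcal S\to[0,\infty)$, with $\widetilde C(\cdot,s)$ nondecreasing, an ancillary cost at stage $0$, $\widetilde H_0:\mathbb R\times\mathcal S\to[0,\infty)$, and an ancillary cost $\widetilde H:\mathbb R^2\times\mathcal S^2\to[0,\infty)$ at stages $t\ge1$ (first argument: previous demand; second argument: current demand). A prime on $\widetilde C$, $\widetilde H_0$, $C^n$, $H^n_0$ denotes the derivative with respect to the first (demand) argument. $C^n,H_0^n,H^n$ are the corresponding cost functions of the $n$-consumer model. **Strategies.** A dynamic oblivious strategy is $\nu=(\nu_0,\dots,\nu_T)$ with $\nu_t:\mathcal X_0\times\mathcal H_t\to\mathcal A$; a consumer using it plays $a_{i,t}=\nu_t(x_{i,0},h_t)$. $\mathfrak V$ denotes the set of all such strategies. **Continuum model and DOE.** If all consumers use $\nu$, the average demand under $h_t$ is $\widetilde A_{t|\nu,h_t}=\sum_{x\in\mathcal X_0}\eta_{s_0}(x)\,\nu_t(x,h_t)$. The induced prices are $\widetilde p_{t|\nu,h_t}=\widetilde C'(\widetilde A_{t|\nu,h_t},s_t)$ for all $t$; $\widetilde q_{0|\nu,h_0}=0$ and $\widetilde w_{0|\nu,h_0}=\widetilde H_0'(\widetilde A_{0|\nu,h_0},s_0)$;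 and, for $t\ge1$, $\widetilde q_{t|\nu,h_t}$ and $\widetilde w_{t|\nu,h_t}$ are the partial derivatives of $\widetilde H$ with respect to its first and second argument, respectively, at $(\widetilde A_{t-1|\nu,h_{t-1}},\widetilde A_{t|\nu,h_t},\overline s_t)$. If consumer $i$ uses $\hat\nu\in\mathfrak V$ while all others use $\nu$, her oblivious value is $$\widetilde V_{i,0}(x_{i,0},s_0\mid\hat\nu,\nu)=\mathbb E\left\{\sum_{t=0}^T\Big[U_t(x_{i,t},s_t,a_{i,t})-(\widetilde p_{t|\nu,h_t}+\widetilde w_{t|\nu,h_t})a_{i,t}-\widetilde q_{t|\nu,h_t}a_{i,t-1}\Big]\right\},$$ where $a_{i,t}=\hat\nu_t(x_{i,0},h_t)$, the states $x_{i,t}$ evolve accordingly, the $t=0$ term involving $a_{i,-1}$ is zero, and the expectation is over $s_1,\dots,s_T$ given $s_0$. A strategy $\nu\in\mathfrak V$ is a Dynamic Oblivious Equilibrium (DOE) if $\sup_{\hat\nu\in\mathfrak V}\widetilde V_{i,0}(x_{i,0},s_0\mid\hat\nu,\nu)=\widetilde V_{i,0}(x_{i,0},s_0\mid\nu,\nu)$ for all $x_{i,0}\in\mathcal X_0$ and $s_0\in\mathcal S$. **$n$-consumer model.** There are $n$ consumers $1,\dots,n$; given $s_0$, their types are drawn independently according to $\eta_{s_0}$ (and independently of the future exogenous states). With aggregate demand $A_t=\sum_{j=1}^n a_{j,t}$, the prices are $p_t=(C^n)'(A_t,s_t)$ for all $t$; $q_0=0$, $w_0=(H^n_0)'(A_0,s_0)$;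 and for $t\ge1$, $q_t=\partial H^n(A_{t-1},A_t,\overline s_t)/\partial A_{t-1}$, $w_t=\partial H^n(A_{t-1},A_t,\overline s_t)/\partial A_t$. Consumer $i$'s stage payoff is $U_t(x_{i,t},s_t,a_{i,t})-(p_t+w_t)a_{i,t}-q_t a_{i,t-1}$ (the last term being zero at $t=0$). Let $f^n_{-i,t}$ be the empirical distribution of the augmented states $y_{j,t}$, $j\neq i$, at stage $t$. A history-dependent strategy for consumer $i$ is $\kappa^n=\{\kappa^n_t\}_{t=0}^T$ of the form $a_{i,t}=\kappa^n_t(y_{i,t},h_t,f^n_{-i,t})\in\mathcal A$; $\mathfrak K_n$ is the set of all such strategies. $V^n_{i,0}(x_{i,0},s_0\mid\kappa^n,\nu)$ is the expected total payoff (sum of stage payoffs over $t=0,\dots,T$) of consumer $i$ with type $x_{i,0}$ and initial global state $s_0$ when she uses $\kappa^n$ and all the other $n-1$ consumers use the dynamic oblivious strategy $\nu$, the expectation being over the types of the other $n-1$ consumers (i.i.d. from $\eta_{s_0}$) and over $s_1,\dots,s_T$. $V^n_{i,0}(x_{i,0},s_0\mid\nu,\nu)$ is the same quantity when consumer $i$ also uses $\nu$. *)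

theory Defs
  imports "HOL-Probability.Probability"
begin

text \<open>
  The derivative relative to \<open>[0,\<infinity>)\<close>: the right derivative at 0, the ordinary derivative at
  every \<open>x > 0\<close>.
\<close>
definition hderiv :: "(real \<Rightarrow> real) \<Rightarrow> real \<Rightarrow> real" where
  "hderiv f x = vector_derivative f (at x within {0..})"

definition hdifferentiable :: "(real \<Rightarrow> real) \<Rightarrow> bool" where
  "hdifferentiable f \<longleftrightarrow> f differentiable_on {0..}"

definition uniformly_equicontinuous_on :: "real set \<Rightarrow> (real \<Rightarrow> real) set \<Rightarrow> bool" where
  "uniformly_equicontinuous_on S F \<longleftrightarrow>
     (\<forall>\<epsilon>>0. \<exists>\<delta>>0. \<forall>f\<in>F. \<forall>x\<in>S. \<forall>y\<in>S. \<bar>x - y\<bar> < \<delta> \<longrightarrow> \<bar>f x - f y\<bar> < \<epsilon>)"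

text \<open>
  A consumer's state is her type at stage 0 and a pair (type, \<open>z\<close>) at later stages. The augmented
  state adds the action of the previous stage, which is \<open>None\<close> at stage 0.
\<close>
datatype 'x cstate = Initial (ctype: 'x) | Later (ctype: 'x) real

type_synonym 'x aug = "real option \<times> 'x cstate"

text \<open>
  The sets of exogenous states and of consumer types are the finite types \<open>'s\<close> and \<open>'x\<close>.
  \<open>trans M t s\<close> is the law of \<open>s\<^sub>t\<^sub>+\<^sub>1\<close> given \<open>s\<^sub>t = s\<close>; the chain may be time-inhomogeneous.
\<close>
record ('x, 's) market =
  horizon :: nat
  max_action :: real
  max_z :: real
  trans :: "nat \<Rightarrow> 's \<Rightarrow> 's pmf"
  type_dist :: "'s \<Rightarrow> 'x pmf"
  z_update :: "'x cstate \<Rightarrow> real \<Rightarrow> 's \<Rightarrow> real"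
  utility :: "nat \<Rightarrow> 'x cstate \<Rightarrow> 's \<Rightarrow> real \<Rightarrow> real"

record 's costs =
  primary :: "real \<Rightarrow> 's \<Rightarrow> real"
  ancillary0 :: "real \<Rightarrow> 's \<Rightarrow> real"
  ancillary :: "real \<Rightarrow> real \<Rightarrow> 's \<times> 's \<Rightarrow> real"

definition actions :: "('x, 's) market \<Rightarrow> real set" where
  "actions M = {0..max_action M}"

definition cstates :: "('x, 's) market \<Rightarrow> nat \<Rightarrow> 'x cstate set" where
  "cstates M t =
     (if t = 0 then range Initial else {Later x z | x z. z \<in> {0..max_z M}})"

definition augs :: "('x, 's) market \<Rightarrow> nat \<Rightarrow> 'x aug set" where
  "augs M t = (if t = 0 then {None} else Some ` actions M) \<times> cstates M t"

definition market_model :: "('x::finite, 's::finite) market \<Rightarrow> bool" where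
  "market_model M \<longleftrightarrow>
     0 < max_action M \<and> 0 \<le> max_z M \<and>
     (\<forall>t<horizon M. \<forall>x\<in>cstates M t. \<forall>a\<in>actions M. \<forall>s.
        z_update M x a s \<in> {0..max_z M}) \<and>
     (\<forall>t\<le>horizon M. \<forall>x\<in>cstates M t. \<forall>s. \<forall>a\<in>actions M. 0 \<le> utility M t x s a)"

definition cost_functions :: "'s costs \<Rightarrow> bool" where
  "cost_functions C \<longleftrightarrow>
     (\<forall>A s. 0 \<le> primary C A s) \<and> (\<forall>s. mono (\<lambda>A. primary C A s)) \<and>
     (\<forall>A s. 0 \<le> ancillary0 C A s) \<and> (\<forall>A A' ss. 0 \<le> ancillary C A A' ss)"

text \<open>
  A history \<open>(s\<^sub>0, \<dots>, s\<^sub>t)\<close> is a list of length \<open>t + 1\<close>. Below, \<open>h\<close> is a full path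
  \<open>(s\<^sub>0, \<dots>, s\<^sub>T)\<close>, so that \<open>take (Suc t) h\<close> is \<open>h\<^sub>t\<close> and \<open>h ! t\<close> is \<open>s\<^sub>t\<close>.
\<close>
primrec path_pmf :: "('x, 's) market \<Rightarrow> 's \<Rightarrow> nat \<Rightarrow> 's list pmf" where
  "path_pmf M s\<^sub>0 0 = return_pmf [s\<^sub>0]"
| "path_pmf M s\<^sub>0 (Suc t) =
     bind_pmf (path_pmf M s\<^sub>0 t)
       (\<lambda>h. map_pmf (\<lambda>s. h @ [s]) (trans M t (last h)))"

type_synonym ('x, 's) obl_strategy = "nat \<Rightarrow> 'x \<Rightarrow> 's list \<Rightarrow> real"

definition obl_strategies :: "('x, 's) market \<Rightarrow> ('x, 's) obl_strategy set" where
  "obl_strategies M =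
     {\<nu>. \<forall>t\<le>horizon M. \<forall>x h. length h = Suc t \<longrightarrow> \<nu> t x h \<in> actions M}"

text \<open>
  The last argument of a history-dependent strategy is the empirical distribution of the other
  consumers' augmented states, given by its mass function. For uniformity in \<open>n\<close> it ranges over
  all functions; the values of a strategy at functions that are not empirical distributions are
  never used.
\<close>
type_synonym ('x, 's) hist_strategy =
  "nat \<Rightarrow> 'x aug \<Rightarrow> 's list \<Rightarrow> ('x aug \<Rightarrow> real) \<Rightarrow> real"

definition hist_strategies :: "('x, 's) market \<Rightarrow> ('x, 's) hist_strategy set" where
  "hist_strategies M =
     {\<kappa>. \<forall>t\<le>horizon M. \<forall>y\<in>augs M t. \<forall>h f. length h = Suc t \<longrightarrow> \<kappa> t y h f \<in> actions M}"

definition as_hist :: "('x, 's) obl_strategy \<Rightarrow> ('x, 's) hist_strategy" where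
  "as_hist \<nu> = (\<lambda>t y h f. \<nu> t (ctype (snd y)) h)"

text \<open>
  The augmented states, along the path \<open>h\<close>, of a consumer of type \<open>x\<close> who at stage \<open>t\<close> and
  augmented state \<open>y\<close> takes the action \<open>g t y\<close>.
\<close>
primrec run :: "('x, 's) market \<Rightarrow> 'x \<Rightarrow> 's list \<Rightarrow> (nat \<Rightarrow> 'x aug \<Rightarrow> real) \<Rightarrow> nat \<Rightarrow> 'x aug" where
  "run M x h g 0 = (None, Initial x)"
| "run M x h g (Suc t) =
     (let y = run M x h g t; a = g t y
      in (Some a, Later x (z_update M (snd y) a (h ! Suc t))))"

text \<open>Prices at stage \<open>t\<close> when the (total or average) demands are \<open>A 0, A 1, \<dots>\<close>.\<close>

definition price_p :: "'s costs \<Rightarrow> (nat \<Rightarrow> real) \<Rightarrow> 's list \<Rightarrow> nat \<Rightarrow> real" where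
  "price_p C A h t = hderiv (\<lambda>u. primary C u (h ! t)) (A t)"

definition price_q :: "'s costs \<Rightarrow> (nat \<Rightarrow> real) \<Rightarrow> 's list \<Rightarrow> nat \<Rightarrow> real" where
  "price_q C A h t =
     (if t = 0 then 0
      else hderiv (\<lambda>u. ancillary C u (A t) (h ! (t - 1), h ! t)) (A (t - 1)))"

definition price_w :: "'s costs \<Rightarrow> (nat \<Rightarrow> real) \<Rightarrow> 's list \<Rightarrow> nat \<Rightarrow> real" where
  "price_w C A h t =
     (if t = 0 then hderiv (\<lambda>u. ancillary0 C u (h ! 0)) (A 0)
      else hderiv (\<lambda>u. ancillary C (A (t - 1)) u (h ! (t - 1), h ! t)) (A t))"

definition total_payoff ::
    "('x, 's) market \<Rightarrow> 's costs \<Rightarrow> (nat \<Rightarrow> real) \<Rightarrow> 's list \<Rightarrow> 'x \<Rightarrow>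
     (nat \<Rightarrow> 'x aug \<Rightarrow> real) \<Rightarrow> real" where
  "total_payoff M C A h x g =
     (\<Sum>t\<le>horizon M.
        let y = run M x h g t; a = g t y
        in utility M t (snd y) (h ! t) a
           - (price_p C A h t + price_w C A h t) * a
           - price_q C A h t * (case fst y of None \<Rightarrow> 0 | Some a' \<Rightarrow> a'))"

definition obl_rule ::
    "('x, 's) obl_strategy \<Rightarrow> 'x \<Rightarrow> 's list \<Rightarrow> nat \<Rightarrow> 'x aug \<Rightarrow> real" where
  "obl_rule \<nu> x h t y = \<nu> t x (take (Suc t) h)"

definition avg_demand ::
    "('x::finite, 's) market \<Rightarrow> ('x, 's) obl_strategy \<Rightarrow> 's list \<Rightarrow> nat \<Rightarrow> real" where
  "avg_demand M \<nu> h t =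
     (\<Sum>x\<in>UNIV. pmf (type_dist M (h ! 0)) x * \<nu> t x (take (Suc t) h))"

definition obl_value ::
    "('x::finite, 's) market \<Rightarrow> 's costs \<Rightarrow> 'x \<Rightarrow> 's \<Rightarrow> ('x, 's) obl_strategy \<Rightarrow>
     ('x, 's) obl_strategy \<Rightarrow> real" where
  "obl_value M C x s\<^sub>0 \<nu>' \<nu> =
     measure_pmf.expectation (path_pmf M s\<^sub>0 (horizon M))
       (\<lambda>h. total_payoff M C (avg_demand M \<nu> h) h x (obl_rule \<nu>' x h))"

text \<open>The supremum is taken in the extended reals, where it always exists.\<close>
definition DOE ::
    "('x::finite, 's) market \<Rightarrow> 's costs \<Rightarrow> ('x, 's) obl_strategy \<Rightarrow> bool" where
  "DOE M C \<nu> \<longleftrightarrow>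
     \<nu> \<in> obl_strategies M \<and>
     (\<forall>x s\<^sub>0. (SUP \<nu>'\<in>obl_strategies M. ereal (obl_value M C x s\<^sub>0 \<nu>' \<nu>))
             = ereal (obl_value M C x s\<^sub>0 \<nu> \<nu>))"

definition empirical :: "nat set \<Rightarrow> (nat \<Rightarrow> 'a) \<Rightarrow> 'a \<Rightarrow> real" where
  "empirical J y = (\<lambda>v. real (card {j\<in>J. y j = v}) / real (card J))"

text \<open>
  In the next three definitions \<open>\<theta>\<close> gives the types of the other consumers, the members of
  \<open>{1..n} - {i}\<close>, all of whom use \<open>\<nu>\<close>.
\<close>
definition others_empirical ::
    "('x, 's) market \<Rightarrow> nat \<Rightarrow> nat \<Rightarrow> (nat \<Rightarrow> 'x) \<Rightarrow> 's list \<Rightarrow> ('x, 's) obl_strategy \<Rightarrow>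
     nat \<Rightarrow> 'x aug \<Rightarrow> real" where
  "others_empirical M n i \<theta> h \<nu> t =
     empirical ({1..n} - {i}) (\<lambda>j. run M (\<theta> j) h (obl_rule \<nu> (\<theta> j) h) t)"

definition hist_rule ::
    "('x, 's) market \<Rightarrow> nat \<Rightarrow> nat \<Rightarrow> (nat \<Rightarrow> 'x) \<Rightarrow> 's list \<Rightarrow> ('x, 's) hist_strategy \<Rightarrow>
     ('x, 's) obl_strategy \<Rightarrow> nat \<Rightarrow> 'x aug \<Rightarrow> real" where
  "hist_rule M n i \<theta> h \<kappa> \<nu> t y =
     \<kappa> t y (take (Suc t) h) (others_empirical M n i \<theta> h \<nu> t)"

definition total_demand ::
    "('x, 's) market \<Rightarrow> nat \<Rightarrow> nat \<Rightarrow> 'x \<Rightarrow> (nat \<Rightarrow> 'x) \<Rightarrow> 's list \<Rightarrow> ('x, 's) hist_strategy \<Rightarrow>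
     ('x, 's) obl_strategy \<Rightarrow> nat \<Rightarrow> real" where
  "total_demand M n i x \<theta> h \<kappa> \<nu> t =
     (let g = hist_rule M n i \<theta> h \<kappa> \<nu> in g t (run M x h g t))
     + (\<Sum>j\<in>{1..n} - {i}. \<nu> t (\<theta> j) (take (Suc t) h))"

definition n_value ::
    "('x::finite, 's) market \<Rightarrow> 's costs \<Rightarrow> nat \<Rightarrow> nat \<Rightarrow> 'x \<Rightarrow> 's \<Rightarrow>
     ('x, 's) hist_strategy \<Rightarrow> ('x, 's) obl_strategy \<Rightarrow> real" where
  "n_value M C n i x s\<^sub>0 \<kappa> \<nu> =
     measure_pmf.expectation
       (pair_pmf (Pi_pmf ({1..n} - {i}) undefined (\<lambda>_. type_dist M s\<^sub>0))
                 (path_pmf M s\<^sub>0 (horizon M)))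
       (\<lambda>(\<theta>, h). total_payoff M C (total_demand M n i x \<theta> h \<kappa> \<nu>) h x
                   (hist_rule M n i \<theta> h \<kappa> \<nu>))"

text \<open>
  The asymptotic Markov equilibrium property; \<open>Cn n\<close> are the cost functions of the
  \<open>n\<close>-consumer model. Consumer \<open>i\<close> takes part in that model only if \<open>n \<ge> i\<close>; the smaller \<open>n\<close> do
  not affect the limit superior.
\<close>
definition AME ::
    "('x::finite, 's) market \<Rightarrow> (nat \<Rightarrow> 's costs) \<Rightarrow> ('x, 's) obl_strategy \<Rightarrow> bool" where
  "AME M Cn \<nu> \<longleftrightarrow>
     (\<forall>i\<ge>1. \<forall>s\<^sub>0 x. \<forall>\<kappa>. (\<forall>n. \<kappa> n \<in> hist_strategies M) \<longrightarrow>
        limsup (\<lambda>n. ereal (n_value M (Cn n) n i x s\<^sub>0 (\<kappa> n) \<nu>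
                           - n_value M (Cn n) n i x s\<^sub>0 (as_hist \<nu>) \<nu>)) \<le> 0)"

definition scaled_costs :: "'s costs \<Rightarrow> nat \<Rightarrow> 's costs \<Rightarrow> bool" where
  "scaled_costs C n Cn \<longleftrightarrow>
     (\<forall>A s. primary Cn A s = real n * primary C (A / real n) s) \<and>
     (\<forall>A s. ancillary0 Cn A s = real n * ancillary0 C (A / real n) s) \<and>
     (\<forall>A A' ss. ancillary Cn A A' ss = real n * ancillary C (A / real n) (A' / real n) ss)"

definition equicontinuous_derivatives :: "('x, 's) market \<Rightarrow> 's costs \<Rightarrow> bool" where
  "equicontinuous_derivatives M C \<longleftrightarrow>
     (\<forall>s. hdifferentiable (\<lambda>A. primary C A s)) \<and>
     (\<forall>s. hdifferentiable (\<lambda>A. ancillary0 C A s)) \<and>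
     (\<forall>A'\<in>actions M. \<forall>ss. hdifferentiable (\<lambda>A. ancillary C A A' ss)) \<and>
     (\<forall>A'\<in>actions M. \<forall>ss. hdifferentiable (\<lambda>A. ancillary C A' A ss)) \<and>
     uniformly_equicontinuous_on {0..} {hderiv (\<lambda>A. primary C A s) | s. True} \<and>
     uniformly_equicontinuous_on {0..} {hderiv (\<lambda>A. ancillary0 C A s) | s. True} \<and>
     uniformly_equicontinuous_on {0..}
       {hderiv (\<lambda>A. ancillary C A A' ss) | A' ss. A' \<in> actions M} \<and>
     uniformly_equicontinuous_on {0..}
       {hderiv (\<lambda>A. ancillary C A' A ss) | A' ss. A' \<in> actions M}"

definition bounded_derivatives :: "('x, 's) market \<Rightarrow> 's costs \<Rightarrow> bool" where
  "bounded_derivatives M C \<longleftrightarrow>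
     (\<exists>P>0. \<forall>A\<in>actions M.
        (\<forall>s. \<bar>hderiv (\<lambda>u. primary C u s) A\<bar> \<le> P \<and> \<bar>hderiv (\<lambda>u. ancillary0 C u s) A\<bar> \<le> P) \<and>
        (\<forall>A'\<in>actions M. \<forall>ss.
           \<bar>hderiv (\<lambda>u. ancillary C u A' ss) A\<bar> \<le> P \<and>
           \<bar>hderiv (\<lambda>u. ancillary C A' u ss) A\<bar> \<le> P))"

definition regular_utility :: "('x, 's) market \<Rightarrow> bool" where
  "regular_utility M \<longleftrightarrow>
     (\<forall>t\<le>horizon M. \<forall>x\<in>cstates M t. \<forall>s. continuous_on (actions M) (utility M t x s)) \<and>
     (\<exists>Q>0. \<forall>t\<le>horizon M. \<forall>x\<in>cstates M t. \<forall>s. \<forall>a\<in>actions M. utility M t x s a \<le> Q)"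

end

theory Submission
  imports Defs
begin

text \<open>
  Fix the types of the other consumers and a path of the exogenous state. The payoff of the consumer
  under consideration in the \<open>n\<close>-consumer model differs from her payoff at the continuum prices by at
  most \<open>\<epsilon> + c * (\<Sum>t. d\<^sub>t\<^sup>2)\<close>, where \<open>d\<^sub>t\<close> is the deviation of per capita demand from average demand
  in the continuum model, since the prices are uniformly continuous and bounded functions of
  demand. The others' demands are i.i.d., so \<open>d\<^sub>t\<close> has second moment at most \<open>2 * B\<^sup>2 / n\<close>, whatever
  strategy the consumer uses. At the continuum prices, a history-dependent strategy is, given the
  others' types, an oblivious one, and the equilibrium property of \<open>\<nu>\<close> bounds its value.
\<close>

section \<open>Expectations over distributions of finite support\<close>

lemma expectation_mono_finite:
  fixes f g :: "'a \<Rightarrow> real"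
  assumes "finite (set_pmf p)" "\<And>x. x \<in> set_pmf p \<Longrightarrow> f x \<le> g x"
  shows "measure_pmf.expectation p f \<le> measure_pmf.expectation p g"
  using assms by (intro integral_mono_AE integrable_measure_pmf_finite) (auto simp: AE_measure_pmf_iff)

lemma expectation_cong_pmf:
  fixes f g :: "'a \<Rightarrow> real"
  assumes "\<And>x. x \<in> set_pmf p \<Longrightarrow> f x = g x"
  shows "measure_pmf.expectation p f = measure_pmf.expectation p g"
  using assms by (intro integral_cong_AE) (auto simp: AE_measure_pmf_iff)

text \<open>Fubini's theorem, with integrability supplied by the finite supports. It is used in both
  orders: types outside paths for the equilibrium inequality, paths outside types for the
  concentration of demand.\<close>

lemma expectation_pair_pmf_finite:
  fixes f :: "'a \<times> 'b \<Rightarrow> real"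
  assumes p: "finite (set_pmf p)" and q: "finite (set_pmf q)"
  shows "measure_pmf.expectation (pair_pmf p q) f =
           measure_pmf.expectation p (\<lambda>x. measure_pmf.expectation q (\<lambda>y. f (x, y)))"
proof -
  have "measure_pmf.expectation (pair_pmf p q) f =
      (\<Sum>x\<in>set_pmf p. pmf p x * measure_pmf.expectation (bind_pmf q (\<lambda>y. return_pmf (x, y))) f)"
    unfolding pair_pmf_def using assms by (subst pmf_expectation_bind[of "set_pmf p"]) auto
  also have "\<dots> = (\<Sum>x\<in>set_pmf p. pmf p x * measure_pmf.expectation q (\<lambda>y. f (x, y)))"
    using map_pmf_def[of _ q] by (simp flip: map_pmf_def)
  also have "\<dots> = measure_pmf.expectation p (\<lambda>x. measure_pmf.expectation q (\<lambda>y. f (x, y)))"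
    by (subst integral_measure_pmf[OF p]) auto
  finally show ?thesis .
qed

lemma finite_set_Pi_pmf:
  assumes "finite J" "\<And>j. j \<in> J \<Longrightarrow> finite (set_pmf (p j))"
  shows "finite (set_pmf (Pi_pmf J d p))"
  using assms by (simp add: set_Pi_pmf finite_PiE_dflt)

text \<open>Induction on the index set. A new independent coordinate contributes its own second
  moment, at most the square of \<open>B\<close>; the cross term vanishes because \<open>f\<close>
  has mean zero.\<close>

lemma second_moment_iid_sum:
  fixes f :: "'a \<Rightarrow> real" and B :: real
  assumes J: "finite J" and p: "finite (set_pmf p)"
    and centred: "measure_pmf.expectation p f = 0"
    and bound: "\<And>x. x \<in> set_pmf p \<Longrightarrow> \<bar>f x\<bar> \<le> B"
  shows "measure_pmf.expectation (Pi_pmf J d (\<lambda>_. p)) (\<lambda>\<theta>. (\<Sum>j\<in>J. f (\<theta> j))\<^sup>2) \<le> card J * B\<^sup>2"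
  using J
proof (induction J rule: finite_induct)
  case empty
  then show ?case by simp
next
  case (insert i J)
  let ?P = "Pi_pmf J d (\<lambda>_. p)"
  let ?S = "\<lambda>\<theta>. \<Sum>j\<in>J. f (\<theta> j)"
  have P: "finite (set_pmf ?P)"
    using insert.hyps p by (intro finite_set_Pi_pmf)
  have int: "integrable (measure_pmf p) g" "integrable (measure_pmf ?P) g'"
    for g :: "'a \<Rightarrow> real" and g' :: "('b \<Rightarrow> 'a) \<Rightarrow> real"
    using p P by (auto intro: integrable_measure_pmf_finite)
  have sum: "(\<Sum>j\<in>insert i J. f ((\<theta>(i := x)) j)) = f x + ?S \<theta>" for x \<theta>
  proof -
    have "(\<Sum>j\<in>J. f ((\<theta>(i := x)) j)) = ?S \<theta>"
      using insert.hyps by (intro sum.cong) auto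
    then show ?thesis using insert.hyps by simp
  qed
  have "measure_pmf.expectation (Pi_pmf (insert i J) d (\<lambda>_. p)) (\<lambda>\<theta>. (\<Sum>j\<in>insert i J. f (\<theta> j))\<^sup>2)
      = measure_pmf.expectation p (\<lambda>x. measure_pmf.expectation ?P (\<lambda>\<theta>. (f x + ?S \<theta>)\<^sup>2))"
    unfolding Pi_pmf_insert[OF insert.hyps] integral_map_pmf
    by (subst expectation_pair_pmf_finite[OF p P]) (simp only: prod.case sum)
  \<comment> \<open>For fixed \<open>x\<close> the value \<open>f x\<close> is a constant under
    \<open>?P\<close>, so the square expands inside the inner expectation and leaves a cross term
    linear in \<open>f x\<close>.\<close>
  also have "\<dots> = measure_pmf.expectation p
      (\<lambda>x. (f x)\<^sup>2 + 2 * f x * measure_pmf.expectation ?P ?S + measure_pmf.expectation ?P (\<lambda>\<theta>. (?S \<theta>)\<^sup>2))"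
    by (simp add: power2_sum int algebra_simps)
  also have "\<dots> = measure_pmf.expectation p (\<lambda>x. (f x)\<^sup>2) + measure_pmf.expectation ?P (\<lambda>\<theta>. (?S \<theta>)\<^sup>2)"
    by (simp add: int centred)
  also have "measure_pmf.expectation p (\<lambda>x. (f x)\<^sup>2) \<le> measure_pmf.expectation p (\<lambda>x. B\<^sup>2)"
  proof (intro expectation_mono_finite p)
    show "(f x)\<^sup>2 \<le> B\<^sup>2" if "x \<in> set_pmf p" for x
      using power_mono[OF bound[OF that], of 2] by simp
  qed
  finally show ?case
    using insert by (simp add: algebra_simps)
qed

subsection \<open>Derivatives on the half-line\<close>

lemma has_real_derivative_hderiv:
  assumes "hdifferentiable f" "0 \<le> x"
  shows "(f has_real_derivative hderiv f x) (at x within {0..})"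
  using assms
  by (simp add: hdifferentiable_def hderiv_def differentiable_on_def
      has_real_derivative_iff_has_vector_derivative flip: vector_derivative_works)

lemma hderiv_eqI:
  assumes "(f has_real_derivative D) (at x within {0..})" "0 \<le> x"
  shows "hderiv f x = D"
proof -
  \<comment> \<open>Uniqueness of the derivative needs \<open>x\<close> to be a limit point of the
    half-line; the segment \<open>{x..x + 1}\<close> shows this also at
    \<open>x = 0\<close>.\<close>
  have "at x within {0..} \<noteq> bot"
    using islimpt_subset[of x "{x..x + 1}" "{0..}"] \<open>0 \<le> x\<close>
    by (simp add: trivial_limit_within islimpt_Icc)
  then show ?thesis
    using assms unfolding hderiv_def
    by (intro vector_derivative_within) (auto simp: has_real_derivative_iff_has_vector_derivative)
qed

text \<open>In the chain rule the inner factor \<open>1 / c\<close> cancels the outer factor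
  \<open>c\<close>. With \<open>c\<close> the number of consumers, marginal costs at total demand
  become continuum marginal costs at per capita demand.\<close>

lemma hderiv_scaled:
  fixes f :: "real \<Rightarrow> real"
  assumes "hdifferentiable f" "0 < c" "0 \<le> x"
  shows "hderiv (\<lambda>u. c * f (u / c)) x = hderiv f (x / c)"
proof (rule hderiv_eqI)
  have "(f has_real_derivative hderiv f (x / c)) (at (x / c) within (\<lambda>u. u / c) ` {0..})"
    using assms by (intro DERIV_subset[OF has_real_derivative_hderiv]) auto
  moreover have "((\<lambda>u. u / c) has_real_derivative 1 / c) (at x within {0..})"
    using assms by (auto intro!: derivative_eq_intros)
  ultimately have "((f \<circ> (\<lambda>u. u / c)) has_real_derivative hderiv f (x / c) * (1 / c)) (at x within {0..})"
    by (rule DERIV_image_chain)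
  from DERIV_cmult[OF this, of c]
  show "((\<lambda>u. c * f (u / c)) has_real_derivative hderiv f (x / c)) (at x within {0..})"
    using assms by (simp add: o_def)
qed (use assms in auto)

text \<open>The interval may start at 0: the mean value theorem asks only for continuity at the end
  points, and inside the half-line \<open>hderiv\<close> is the ordinary derivative.\<close>

lemma hderiv_mean_value:
  assumes "hdifferentiable f" "0 \<le> a" "a < b"
  obtains \<xi> where "a < \<xi>" "\<xi> < b" "f b - f a = (b - a) * hderiv f \<xi>"
proof -
  have "continuous_on {0..} f"
    using assms by (simp add: hdifferentiable_def differentiable_imp_continuous_on)
  then have "continuous_on {a..b} f"
    by (rule continuous_on_subset) (use assms in auto)
  moreover have "(f has_derivative (*) (hderiv f x)) (at x)" if "a < x" "x < b" for x
  proof -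
    have "x \<in> interior {0..}"
      using that assms by simp
    moreover have "(f has_real_derivative hderiv f x) (at x within {0..})"
      using that assms by (intro has_real_derivative_hderiv) auto
    ultimately show ?thesis
      by (simp only: has_field_derivative_def at_within_interior)
  qed
  ultimately obtain \<xi> where "a < \<xi>" "\<xi> < b" "f b - f a = hderiv f \<xi> * (b - a)"
    using mvt[OF \<open>a < b\<close>, of f "\<lambda>x. (*) (hderiv f x)"] by auto
  then show ?thesis
    by (auto intro: that simp: mult.commute)
qed

lemma hderiv_bound_imp_lipschitz:
  assumes f: "hdifferentiable f" and P: "\<And>x. x \<in> {0..B} \<Longrightarrow> \<bar>hderiv f x\<bar> \<le> P"
    and "a \<in> {0..B}" "b \<in> {0..B}"
  shows "\<bar>f a - f b\<bar> \<le> P * \<bar>a - b\<bar>"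
proof -
  have *: "\<bar>f b - f a\<bar> \<le> P * \<bar>b - a\<bar>" if ab: "a < b" "a \<in> {0..B}" "b \<in> {0..B}" for a b
  proof -
    obtain \<xi> where "a < \<xi>" "\<xi> < b" "f b - f a = (b - a) * hderiv f \<xi>"
      using hderiv_mean_value[OF f, of a b] ab by auto
    with P[of \<xi>] ab show ?thesis
      by (simp add: abs_mult mult.commute mult_right_mono)
  qed
  show ?thesis
    using *[of a b] *[of b a] assms by (cases a b rule: linorder_cases) (auto simp: abs_minus_commute)
qed

text \<open>
  The hypotheses say nothing about how the partial derivative depends on the other argument. But \<open>G\<close>
  is Lipschitz in that argument, so difference quotients of \<open>G\<close> over an interval of length \<open>l\<close> vary
  by at most \<open>2 * P / l\<close> times its change, and by equicontinuity the derivative is close to such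
  a quotient when \<open>l\<close> is small.
\<close>
lemma partial_hderiv_jointly_uniformly_continuous:
  fixes G :: "real \<Rightarrow> real \<Rightarrow> 'k \<Rightarrow> real"
  assumes B: "0 < B"
    and diff1: "\<And>b k. b \<in> {0..B} \<Longrightarrow> hdifferentiable (\<lambda>u. G u b k)"
    and diff2: "\<And>a k. a \<in> {0..B} \<Longrightarrow> hdifferentiable (\<lambda>u. G a u k)"
    and equi: "uniformly_equicontinuous_on {0..} {hderiv (\<lambda>u. G u b k) | b k. b \<in> {0..B}}"
    and P: "\<And>a b k. a \<in> {0..B} \<Longrightarrow> b \<in> {0..B} \<Longrightarrow> \<bar>hderiv (\<lambda>u. G a u k) b\<bar> \<le> P"
    and e: "0 < \<epsilon>"
  obtains \<delta> where "0 < \<delta>"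
    "\<And>a b a' b' k. a \<in> {0..B} \<Longrightarrow> b \<in> {0..B} \<Longrightarrow> a' \<in> {0..B} \<Longrightarrow> b' \<in> {0..B} \<Longrightarrow>
      \<bar>a - a'\<bar> < \<delta> \<Longrightarrow> \<bar>b - b'\<bar> < \<delta> \<Longrightarrow>
      \<bar>hderiv (\<lambda>u. G u b k) a - hderiv (\<lambda>u. G u b' k) a'\<bar> < \<epsilon>"
proof -
  define D where "D = (\<lambda>a b k. hderiv (\<lambda>u. G u b k) a)"
  let ?F = "{hderiv (\<lambda>u. G u b k) | b k. b \<in> {0..B}}"
  have "\<exists>\<delta>>0. \<forall>f\<in>?F. \<forall>x\<in>{0..}. \<forall>y\<in>{0..}. \<bar>x - y\<bar> < \<delta> \<longrightarrow> \<bar>f x - f y\<bar> < \<epsilon> / 4"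
    by (rule equi[unfolded uniformly_equicontinuous_on_def, THEN spec, THEN mp]) (use e in simp)
  then obtain \<delta> where \<delta>: "0 < \<delta>"
      "\<forall>f\<in>?F. \<forall>x\<in>{0..}. \<forall>y\<in>{0..}. \<bar>x - y\<bar> < \<delta> \<longrightarrow> \<bar>f x - f y\<bar> < \<epsilon> / 4"
    by (elim exE conjE) (rule that)
  have D\<delta>: "\<bar>D x b k - D y b k\<bar> < \<epsilon> / 4"
    if "b \<in> {0..B}" "0 \<le> x" "0 \<le> y" "\<bar>x - y\<bar> < \<delta>" for x y b k
  proof -
    have "hderiv (\<lambda>u. G u b k) \<in> ?F"
      using that(1) by blast
    from \<delta>(2)[THEN bspec, OF this, THEN bspec, of x, THEN bspec, of y] that show ?thesis
      by (simp add: D_def)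
  qed
  have "0 \<le> P"
    using order_trans[OF abs_ge_zero P[of 0 0]] B by simp
  \<comment> \<open>\<open>l < \<delta>\<close> keeps all points of an interval of length
    \<open>l\<close> within reach of equicontinuity; \<open>2 * l \<le> B\<close> leaves room in
    \<open>{0..B}\<close> for such an interval around any \<open>a\<close>, extending to its right
    or to its left.\<close>
  define l where "l = min \<delta> B / 2"
  have l: "0 < l" "l < \<delta>" "2 * l \<le> B"
    using \<delta>(1) B by (auto simp: l_def)
  have D2: "\<bar>D a b k - D a b' k\<bar> < \<epsilon> / 2 + 2 * P * \<bar>b - b'\<bar> / l"
    if ab: "a \<in> {0..B}" "b \<in> {0..B}" "b' \<in> {0..B}" for a b b' k
  proof -
    obtain m where m: "0 \<le> m" "m \<le> a" "a \<le> m + l" "m + l \<le> B"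
    proof (cases "a + l \<le> B")
      case True
      show ?thesis by (rule that[of a]) (use True ab l in auto)
    next
      case False
      show ?thesis by (rule that[of "a - l"]) (use False ab l in auto)
    qed
    obtain x where x: "m < x" "x < m + l" "G (m + l) b k - G m b k = l * D x b k"
      using hderiv_mean_value[OF diff1, of b m "m + l" k] ab m l unfolding D_def by auto
    obtain x' where x': "m < x'" "x' < m + l" "G (m + l) b' k - G m b' k = l * D x' b' k"
      using hderiv_mean_value[OF diff1, of b' m "m + l" k] ab m l unfolding D_def by auto
    have L: "\<bar>G c b k - G c b' k\<bar> \<le> P * \<bar>b - b'\<bar>" if "c \<in> {0..B}" for c
      using hderiv_bound_imp_lipschitz[of "\<lambda>u. G c u k" B P b b'] diff2 P that ab by auto
    \<comment> \<open>The difference of two increments in the first argument is regrouped into two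
      increments in the second argument, to which the Lipschitz bound \<open>L\<close>
      applies.\<close>
    have "l * (D x b k - D x' b' k) = (G (m + l) b k - G (m + l) b' k) - (G m b k - G m b' k)"
      using x x' by (simp add: right_diff_distrib)
    then have "\<bar>l * (D x b k - D x' b' k)\<bar> \<le> 2 * P * \<bar>b - b'\<bar>"
      using L[of "m + l"] L[of m] m l by auto
    then have "\<bar>D x b k - D x' b' k\<bar> \<le> 2 * P * \<bar>b - b'\<bar> / l"
      using l(1) by (simp only: abs_mult abs_of_pos pos_le_divide_eq mult.commute[of l])
    moreover have "\<bar>D a b k - D x b k\<bar> < \<epsilon> / 4"
      using x m l ab by (intro D\<delta>) auto
    moreover have "\<bar>D a b' k - D x' b' k\<bar> < \<epsilon> / 4"
      using x' m l ab by (intro D\<delta>) auto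
    ultimately show ?thesis by linarith
  qed
  \<comment> \<open>The second entry makes the Lipschitz term of \<open>D2\<close> at most
    \<open>\<epsilon> / 4\<close>, and the first lets equicontinuity move \<open>a\<close> to
    \<open>a'\<close> at the cost of another \<open>\<epsilon> / 4\<close>. Using
    \<open>P + 1\<close> avoids dividing by zero when \<open>P = 0\<close>.\<close>
  define \<gamma> where "\<gamma> = min \<delta> (l * \<epsilon> / (8 * (P + 1)))"
  show thesis
  proof (rule that)
    show "0 < \<gamma>" using \<delta>(1) l e \<open>0 \<le> P\<close> by (simp add: \<gamma>_def)
    fix a b a' b' k
    assume ab: "a \<in> {0..B}" "b \<in> {0..B}" "a' \<in> {0..B}" "b' \<in> {0..B}"
      "\<bar>a - a'\<bar> < \<gamma>" "\<bar>b - b'\<bar> < \<gamma>"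
    have "\<bar>b - b'\<bar> \<le> l * \<epsilon> / (8 * (P + 1))"
      using ab by (simp add: \<gamma>_def)
    then have "2 * (P + 1) * \<bar>b - b'\<bar> / l \<le> \<epsilon> / 4"
      using l \<open>0 \<le> P\<close> by (simp add: field_simps)
    moreover have "2 * P * \<bar>b - b'\<bar> / l \<le> 2 * (P + 1) * \<bar>b - b'\<bar> / l"
      using l by (intro divide_right_mono mult_right_mono) auto
    moreover have "\<bar>D a b' k - D a' b' k\<bar> < \<epsilon> / 4"
      using ab by (intro D\<delta>) (auto simp: \<gamma>_def)
    moreover note D2[OF ab(1,2,4), of k]
    ultimately have "\<bar>D a b k - D a' b' k\<bar> < \<epsilon>" by linarith
    then show "\<bar>hderiv (\<lambda>u. G u b k) a - hderiv (\<lambda>u. G u b' k) a'\<bar> < \<epsilon>"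
      by (simp add: D_def)
  qed
qed

text \<open>Uniform continuity handles arguments closer than \<open>\<delta>\<close>. Farther apart,
  the difference is at most \<open>2 * P\<close>, and the squared distance divided by the square of
  \<open>\<delta>\<close> is at least 1. A bound of this form can be integrated knowing only second
  moments of demand.\<close>

lemma partial_hderiv_quadratic_modulus:
  fixes G :: "real \<Rightarrow> real \<Rightarrow> 'k \<Rightarrow> real"
  assumes B: "0 < B"
    and diff1: "\<And>b k. b \<in> {0..B} \<Longrightarrow> hdifferentiable (\<lambda>u. G u b k)"
    and diff2: "\<And>a k. a \<in> {0..B} \<Longrightarrow> hdifferentiable (\<lambda>u. G a u k)"
    and equi: "uniformly_equicontinuous_on {0..} {hderiv (\<lambda>u. G u b k) | b k. b \<in> {0..B}}"
    and P1: "\<And>a b k. a \<in> {0..B} \<Longrightarrow> b \<in> {0..B} \<Longrightarrow> \<bar>hderiv (\<lambda>u. G u b k) a\<bar> \<le> P"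
    and P2: "\<And>a b k. a \<in> {0..B} \<Longrightarrow> b \<in> {0..B} \<Longrightarrow> \<bar>hderiv (\<lambda>u. G a u k) b\<bar> \<le> P"
    and e: "0 < \<epsilon>"
  obtains c where "0 \<le> c"
    "\<And>a b a' b' k. a \<in> {0..B} \<Longrightarrow> b \<in> {0..B} \<Longrightarrow> a' \<in> {0..B} \<Longrightarrow> b' \<in> {0..B} \<Longrightarrow>
      \<bar>hderiv (\<lambda>u. G u b k) a - hderiv (\<lambda>u. G u b' k) a'\<bar> \<le> \<epsilon> + c * ((a - a')\<^sup>2 + (b - b')\<^sup>2)"
proof -
  obtain \<delta> where \<delta>: "0 < \<delta>"
    and close: "\<And>a b a' b' k. a \<in> {0..B} \<Longrightarrow> b \<in> {0..B} \<Longrightarrow> a' \<in> {0..B} \<Longrightarrow> b' \<in> {0..B} \<Longrightarrow>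
      \<bar>a - a'\<bar> < \<delta> \<Longrightarrow> \<bar>b - b'\<bar> < \<delta> \<Longrightarrow>
      \<bar>hderiv (\<lambda>u. G u b k) a - hderiv (\<lambda>u. G u b' k) a'\<bar> < \<epsilon>"
    using partial_hderiv_jointly_uniformly_continuous[of B G P \<epsilon>, OF B diff1 diff2 equi P2 e] by blast
  have "0 \<le> P"
    using order_trans[OF abs_ge_zero P1[of 0 0]] B by simp
  show thesis
  proof (rule that)
    show "0 \<le> 2 * P / \<delta>\<^sup>2"
      using \<open>0 \<le> P\<close> by simp
    fix a b a' b' k
    assume ab: "a \<in> {0..B}" "b \<in> {0..B}" "a' \<in> {0..B}" "b' \<in> {0..B}"
    let ?d = "\<bar>hderiv (\<lambda>u. G u b k) a - hderiv (\<lambda>u. G u b' k) a'\<bar>"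
    let ?s = "(a - a')\<^sup>2 + (b - b')\<^sup>2"
    have s: "0 \<le> 2 * P / \<delta>\<^sup>2 * ?s"
      using \<open>0 \<le> P\<close> by simp
    show "?d \<le> \<epsilon> + 2 * P / \<delta>\<^sup>2 * ?s"
    proof (cases "?s < \<delta>\<^sup>2")
      case True
      then have "\<bar>a - a'\<bar>\<^sup>2 < \<delta>\<^sup>2" "\<bar>b - b'\<bar>\<^sup>2 < \<delta>\<^sup>2"
        using zero_le_power2[of "a - a'"] zero_le_power2[of "b - b'"] unfolding power2_abs
        by linarith+
      then have "\<bar>a - a'\<bar> < \<delta>" "\<bar>b - b'\<bar> < \<delta>"
        using \<delta> by (auto intro: power2_less_imp_less)
      then show ?thesis
        using close[OF ab, of k] s by linarith
    next
      case False
      then have "2 * P * 1 \<le> 2 * P * (?s / \<delta>\<^sup>2)"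
        using \<delta> \<open>0 \<le> P\<close> by (intro mult_left_mono) auto
      moreover have "?d \<le> 2 * P"
        using P1[OF ab(1,2), of k] P1[OF ab(3,4), of k] by linarith
      ultimately show ?thesis
        using e by simp
    qed
  qed
qed

lemma hderiv_const: "0 \<le> x \<Longrightarrow> hderiv (\<lambda>_. c) x = 0"
  by (rule hderiv_eqI) auto

text \<open>This is the two-argument bound for a function that ignores its second argument, so that
  its derivative in that argument is zero.\<close>

lemma hderiv_quadratic_modulus:
  fixes F :: "real \<Rightarrow> 'k \<Rightarrow> real"
  assumes B: "0 < B"
    and diff: "\<And>k. hdifferentiable (\<lambda>u. F u k)"
    and equi: "uniformly_equicontinuous_on {0..} {hderiv (\<lambda>u. F u k) | k. True}"
    and P: "\<And>a k. a \<in> {0..B} \<Longrightarrow> \<bar>hderiv (\<lambda>u. F u k) a\<bar> \<le> P"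
    and e: "0 < \<epsilon>"
  obtains c where "0 \<le> c"
    "\<And>a a' k. a \<in> {0..B} \<Longrightarrow> a' \<in> {0..B} \<Longrightarrow>
      \<bar>hderiv (\<lambda>u. F u k) a - hderiv (\<lambda>u. F u k) a'\<bar> \<le> \<epsilon> + c * (a - a')\<^sup>2"
proof -
  have "0 \<in> {0..B}"
    using B by simp
  \<comment> \<open>The dummy argument \<open>b\<close> leaves the family of derivatives unchanged
    because its range is nonempty.\<close>
  then have eq: "{hderiv (\<lambda>u. F u k) | b k. b \<in> {0..B}} = {hderiv (\<lambda>u. F u k) | k. True}"
    by blast
  have "0 \<le> P"
    using order_trans[OF abs_ge_zero P[of 0]] B by simp
  have const: "hdifferentiable (\<lambda>_. c)" for c
    by (simp add: hdifferentiable_def)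
  obtain c where c: "0 \<le> c"
    "\<And>a b a' b' k. a \<in> {0..B} \<Longrightarrow> b \<in> {0..B} \<Longrightarrow> a' \<in> {0..B} \<Longrightarrow> b' \<in> {0..B} \<Longrightarrow>
      \<bar>hderiv (\<lambda>u. F u k) a - hderiv (\<lambda>u. F u k) a'\<bar> \<le> \<epsilon> + c * ((a - a')\<^sup>2 + (b - b')\<^sup>2)"
    using partial_hderiv_quadratic_modulus[of B "\<lambda>u b k. F u k" P \<epsilon>, unfolded eq,
        OF B diff const equi P _ e] \<open>0 \<le> P\<close> by (auto simp: hderiv_const)
  have "\<bar>hderiv (\<lambda>u. F u k) a - hderiv (\<lambda>u. F u k) a'\<bar> \<le> \<epsilon> + c * (a - a')\<^sup>2"
    if "a \<in> {0..B}" "a' \<in> {0..B}" for a a' k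
    using c(2)[of a 0 a' 0 k] that B by simp
  with c(1) show thesis
    by (rule that)
qed

subsection \<open>Sensitivity of payoffs to demand\<close>

text \<open>A price at stage \<open>t\<close> depends on demand at stages \<open>t\<close> and
  \<open>t - 1\<close> at most. Summing the squares over all stages up to \<open>t\<close> and
  adding the four constants gives one bound that serves all three prices.\<close>

lemma price_differences_bound:
  fixes M :: "('x::finite, 's::finite) market"
  assumes M: "market_model M" and equi: "equicontinuous_derivatives M C"
    and bounded: "bounded_derivatives M C" and e: "0 < \<epsilon>"
  obtains c where "0 \<le> c"
    "\<And>A A' h t. (\<And>s. s \<le> t \<Longrightarrow> A s \<in> actions M) \<Longrightarrow> (\<And>s. s \<le> t \<Longrightarrow> A' s \<in> actions M) \<Longrightarrow>
      \<bar>price_p C A h t - price_p C A' h t\<bar> \<le> \<epsilon> + c * (\<Sum>s\<le>t. (A s - A' s)\<^sup>2) \<and>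
      \<bar>price_q C A h t - price_q C A' h t\<bar> \<le> \<epsilon> + c * (\<Sum>s\<le>t. (A s - A' s)\<^sup>2) \<and>
      \<bar>price_w C A h t - price_w C A' h t\<bar> \<le> \<epsilon> + c * (\<Sum>s\<le>t. (A s - A' s)\<^sup>2)"
proof -
  define B where "B = max_action M"
  have act: "actions M = {0..B}"
    by (simp add: actions_def B_def)
  have B: "0 < B"
    using M by (simp add: market_model_def B_def)
  note equi = equi[unfolded equicontinuous_derivatives_def act]
  obtain P where P:
    "\<And>A s. A \<in> {0..B} \<Longrightarrow> \<bar>hderiv (\<lambda>u. primary C u s) A\<bar> \<le> P"
    "\<And>A s. A \<in> {0..B} \<Longrightarrow> \<bar>hderiv (\<lambda>u. ancillary0 C u s) A\<bar> \<le> P"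
    "\<And>A A' ss. A \<in> {0..B} \<Longrightarrow> A' \<in> {0..B} \<Longrightarrow> \<bar>hderiv (\<lambda>u. ancillary C u A' ss) A\<bar> \<le> P"
    "\<And>A A' ss. A \<in> {0..B} \<Longrightarrow> A' \<in> {0..B} \<Longrightarrow> \<bar>hderiv (\<lambda>u. ancillary C A' u ss) A\<bar> \<le> P"
    using bounded unfolding bounded_derivatives_def act by blast
  obtain c1 where c1: "0 \<le> c1"
    "\<And>a a' k. a \<in> {0..B} \<Longrightarrow> a' \<in> {0..B} \<Longrightarrow>
      \<bar>hderiv (\<lambda>u. primary C u k) a - hderiv (\<lambda>u. primary C u k) a'\<bar> \<le> \<epsilon> + c1 * (a - a')\<^sup>2"
    by (rule hderiv_quadratic_modulus[of B "primary C" P \<epsilon>]) (use B equi P e in auto)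
  obtain c2 where c2: "0 \<le> c2"
    "\<And>a a' k. a \<in> {0..B} \<Longrightarrow> a' \<in> {0..B} \<Longrightarrow>
      \<bar>hderiv (\<lambda>u. ancillary0 C u k) a - hderiv (\<lambda>u. ancillary0 C u k) a'\<bar> \<le> \<epsilon> + c2 * (a - a')\<^sup>2"
    by (rule hderiv_quadratic_modulus[of B "ancillary0 C" P \<epsilon>]) (use B equi P e in auto)
  obtain c3 where c3: "0 \<le> c3"
    "\<And>a b a' b' k. a \<in> {0..B} \<Longrightarrow> b \<in> {0..B} \<Longrightarrow> a' \<in> {0..B} \<Longrightarrow> b' \<in> {0..B} \<Longrightarrow>
      \<bar>hderiv (\<lambda>u. ancillary C u b k) a - hderiv (\<lambda>u. ancillary C u b' k) a'\<bar>
        \<le> \<epsilon> + c3 * ((a - a')\<^sup>2 + (b - b')\<^sup>2)"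
    by (rule partial_hderiv_quadratic_modulus[of B "ancillary C" P \<epsilon>]) (use B equi P e in auto)
  \<comment> \<open>The modulus concerns derivatives in the first argument, so the arguments of
    \<open>ancillary\<close> are swapped for the price \<open>w\<close>.\<close>
  obtain c4 where c4: "0 \<le> c4"
    "\<And>a b a' b' k. a \<in> {0..B} \<Longrightarrow> b \<in> {0..B} \<Longrightarrow> a' \<in> {0..B} \<Longrightarrow> b' \<in> {0..B} \<Longrightarrow>
      \<bar>hderiv (\<lambda>u. ancillary C b u k) a - hderiv (\<lambda>u. ancillary C b' u k) a'\<bar>
        \<le> \<epsilon> + c4 * ((a - a')\<^sup>2 + (b - b')\<^sup>2)"
    by (rule partial_hderiv_quadratic_modulus[of B "\<lambda>u b. ancillary C b u" P \<epsilon>])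
      (use B equi P e in auto)
  define c where "c = c1 + c2 + c3 + c4"
  have c: "0 \<le> c" "c1 \<le> c" "c2 \<le> c" "c3 \<le> c" "c4 \<le> c"
    using c1(1) c2(1) c3(1) c4(1) by (auto simp: c_def)
  show thesis
  proof (rule that[OF \<open>0 \<le> c\<close>])
    fix A A' :: "nat \<Rightarrow> real" and h :: "'s list" and t
    assume "\<And>s. s \<le> t \<Longrightarrow> A s \<in> actions M" "\<And>s. s \<le> t \<Longrightarrow> A' s \<in> actions M"
    then have A: "A t \<in> {0..B}" "A (t - 1) \<in> {0..B}" "A' t \<in> {0..B}" "A' (t - 1) \<in> {0..B}"
      by (simp_all add: act)
    let ?S = "\<Sum>s\<le>t. (A s - A' s)\<^sup>2"
    have S1: "(A t - A' t)\<^sup>2 \<le> ?S"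
      by (rule member_le_sum) auto
    \<comment> \<open>At \<open>t = 0\<close> truncated subtraction makes both squares the same
      summand of \<open>?S\<close>, hence the restriction.\<close>
    have S2: "(A t - A' t)\<^sup>2 + (A (t - 1) - A' (t - 1))\<^sup>2 \<le> ?S" if "t \<noteq> 0"
    proof -
      have "(\<Sum>s\<in>{t, t - 1}. (A s - A' s)\<^sup>2) \<le> ?S"
        by (rule sum_mono2) auto
      with that show ?thesis by simp
    qed
    have *: "\<epsilon> + c' * s \<le> \<epsilon> + c * ?S" if "0 \<le> c'" "c' \<le> c" "s \<le> ?S" "0 \<le> s" for c' s
      using that c by (intro add_left_mono mult_mono) auto
    have "\<bar>price_p C A h t - price_p C A' h t\<bar> \<le> \<epsilon> + c * ?S"
      unfolding price_p_def using c1(2)[OF A(1,3)] *[OF c1(1) c(2) S1] by (meson order_trans zero_le_power2)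
    moreover have "\<bar>price_q C A h t - price_q C A' h t\<bar> \<le> \<epsilon> + c * ?S"
    proof (cases "t = 0")
      case True
      then show ?thesis
        using e c by (simp add: price_q_def)
    next
      case False
      have "\<bar>price_q C A h t - price_q C A' h t\<bar>
          \<le> \<epsilon> + c3 * ((A (t - 1) - A' (t - 1))\<^sup>2 + (A t - A' t)\<^sup>2)"
        using c3(2)[OF A(2,1,4,3)] False by (simp add: price_q_def)
      also have "\<dots> \<le> \<epsilon> + c * ?S"
        using S2[OF False] c3(1) c by (intro *) auto
      finally show ?thesis .
    qed
    moreover have "\<bar>price_w C A h t - price_w C A' h t\<bar> \<le> \<epsilon> + c * ?S"
    proof (cases "t = 0")
      case True
      have "\<bar>price_w C A h t - price_w C A' h t\<bar> \<le> \<epsilon> + c2 * (A t - A' t)\<^sup>2"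
        using c2(2)[OF A(1,3)] True by (simp add: price_w_def)
      also have "\<dots> \<le> \<epsilon> + c * ?S"
        using S1 c2(1) c by (intro *) auto
      finally show ?thesis .
    next
      case False
      have "\<bar>price_w C A h t - price_w C A' h t\<bar>
          \<le> \<epsilon> + c4 * ((A t - A' t)\<^sup>2 + (A (t - 1) - A' (t - 1))\<^sup>2)"
        using c4(2)[OF A(1,2,3,4)] False by (simp add: price_w_def)
      also have "\<dots> \<le> \<epsilon> + c * ?S"
        using S2[OF False] c4(1) c by (intro *) auto
      finally show ?thesis .
    qed
    ultimately show "\<bar>price_p C A h t - price_p C A' h t\<bar> \<le> \<epsilon> + c * ?S \<and>
        \<bar>price_q C A h t - price_q C A' h t\<bar> \<le> \<epsilon> + c * ?S \<and>
        \<bar>price_w C A h t - price_w C A' h t\<bar> \<le> \<epsilon> + c * ?S"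
      by blast
  qed
qed

lemma run_in_augs:
  assumes M: "market_model M" and "t \<le> horizon M"
    and "\<And>s y. s < t \<Longrightarrow> y \<in> augs M s \<Longrightarrow> g s y \<in> actions M"
  shows "run M x h g t \<in> augs M t"
  using assms(2,3)
proof (induction t)
  case 0
  then show ?case by (simp add: augs_def cstates_def)
next
  case (Suc t)
  let ?y = "run M x h g t"
  have y: "?y \<in> augs M t"
    using Suc by simp
  then have "g t ?y \<in> actions M" "snd ?y \<in> cstates M t"
    using Suc.prems by (auto simp: augs_def)
  moreover from this have "z_update M (snd ?y) (g t ?y) (h ! Suc t) \<in> {0..max_z M}"
    using M Suc.prems by (simp add: market_model_def Suc_le_eq)
  ultimately show ?case
    by (auto simp: augs_def cstates_def Let_def)
qed

text \<open>States and actions are determined by \<open>g\<close> and the path, not by the demands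
  that set the prices. Hence the utilities cancel, and each price difference is multiplied by an
  action of size at most \<open>max_action M\<close>. The constant is independent of the rule
  \<open>g\<close>.\<close>

lemma total_payoff_difference_bound:
  fixes M :: "('x::finite, 's::finite) market"
  assumes M: "market_model M" and equi: "equicontinuous_derivatives M C"
    and bounded: "bounded_derivatives M C" and e: "0 < \<epsilon>"
  obtains c where "0 \<le> c"
    "\<And>A A' h x g. (\<And>t. t \<le> horizon M \<Longrightarrow> A t \<in> actions M) \<Longrightarrow>
      (\<And>t. t \<le> horizon M \<Longrightarrow> A' t \<in> actions M) \<Longrightarrow>
      (\<And>t y. t \<le> horizon M \<Longrightarrow> y \<in> augs M t \<Longrightarrow> g t y \<in> actions M) \<Longrightarrow>
      \<bar>total_payoff M C A h x g - total_payoff M C A' h x g\<bar>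
        \<le> \<epsilon> + c * (\<Sum>t\<le>horizon M. (A t - A' t)\<^sup>2)"
proof -
  define B where "B = max_action M"
  define T where "T = horizon M"
  have act: "actions M = {0..B}"
    by (simp add: actions_def B_def)
  have B: "0 < B"
    using M by (simp add: market_model_def B_def)
  \<comment> \<open>There are \<open>T + 1\<close> stages, each with three price terms multiplied by
    actions of size at most \<open>B\<close>; prices are therefore controlled to within
    \<open>\<epsilon> / K\<close>.\<close>
  define K where "K = (real T + 1) * (3 * B)"
  have K: "0 < K"
    using B by (simp add: K_def)
  obtain c where c: "0 \<le> c"
    and price: "\<And>A A' h t. (\<And>s. s \<le> t \<Longrightarrow> A s \<in> actions M) \<Longrightarrow> (\<And>s. s \<le> t \<Longrightarrow> A' s \<in> actions M) \<Longrightarrow>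
      \<bar>price_p C A h t - price_p C A' h t\<bar> \<le> \<epsilon> / K + c * (\<Sum>s\<le>t. (A s - A' s)\<^sup>2) \<and>
      \<bar>price_q C A h t - price_q C A' h t\<bar> \<le> \<epsilon> / K + c * (\<Sum>s\<le>t. (A s - A' s)\<^sup>2) \<and>
      \<bar>price_w C A h t - price_w C A' h t\<bar> \<le> \<epsilon> / K + c * (\<Sum>s\<le>t. (A s - A' s)\<^sup>2)"
    using price_differences_bound[OF M equi bounded divide_pos_pos[OF e K]] by blast
  show thesis
  proof (rule that)
    show "0 \<le> K * c"
      using K c by simp
    fix A A' :: "nat \<Rightarrow> real" and h :: "'s list" and x :: 'x and g
    assume A: "\<And>t. t \<le> horizon M \<Longrightarrow> A t \<in> actions M" "\<And>t. t \<le> horizon M \<Longrightarrow> A' t \<in> actions M"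
      and g: "\<And>t y. t \<le> horizon M \<Longrightarrow> y \<in> augs M t \<Longrightarrow> g t y \<in> actions M"
    let ?S = "\<Sum>t\<le>T. (A t - A' t)\<^sup>2"
    let ?D = "\<epsilon> / K + c * ?S"
    define y where "y = run M x h g"
    define a where "a = (\<lambda>t. g t (y t))"
    define a' where "a' = (\<lambda>t. case fst (y t) of None \<Rightarrow> 0 | Some u \<Rightarrow> u)"
    define dp where "dp = (\<lambda>t. price_p C A h t - price_p C A' h t)"
    define dq where "dq = (\<lambda>t. price_q C A h t - price_q C A' h t)"
    define dw where "dw = (\<lambda>t. price_w C A h t - price_w C A' h t)"
    have summand: "\<bar>- (dp t + dw t) * a t - dq t * a' t\<bar> \<le> 3 * B * ?D" if t: "t \<in> {..T}" for t
    proof -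
      have y: "y t \<in> augs M t"
        unfolding y_def using t by (intro run_in_augs M g) (auto simp: T_def)
      then have a: "\<bar>a t\<bar> \<le> B"
        using g[of t "y t"] t by (simp add: a_def act T_def)
      have a': "\<bar>a' t\<bar> \<le> B"
        using y B by (auto simp: a'_def augs_def act split: if_splits)
      have "(\<Sum>s\<le>t. (A s - A' s)\<^sup>2) \<le> ?S"
        using t by (intro sum_mono2) auto
      then have "\<epsilon> / K + c * (\<Sum>s\<le>t. (A s - A' s)\<^sup>2) \<le> ?D"
        using c by (intro add_left_mono mult_left_mono)
      with price[of t A A' h] A t have d: "\<bar>dp t\<bar> \<le> ?D" "\<bar>dq t\<bar> \<le> ?D" "\<bar>dw t\<bar> \<le> ?D"
        by (auto simp: dp_def dq_def dw_def T_def)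
      have "\<bar>dp t * a t\<bar> \<le> ?D * B" "\<bar>dw t * a t\<bar> \<le> ?D * B" "\<bar>dq t * a' t\<bar> \<le> ?D * B"
        using d a a' unfolding abs_mult by (auto intro!: mult_mono)
      then have "\<bar>dp t * a t\<bar> + \<bar>dw t * a t\<bar> + \<bar>dq t * a' t\<bar> \<le> ?D * B + ?D * B + ?D * B"
        by linarith
      moreover have "?D * B + ?D * B + ?D * B = 3 * B * ?D"
        by (simp only: mult.commute[of ?D])
      moreover have "- (dp t + dw t) * a t - dq t * a' t = - (dp t * a t) - dw t * a t - dq t * a' t"
        by (simp add: algebra_simps)
      ultimately show ?thesis by linarith
    qed
    have "total_payoff M C A h x g - total_payoff M C A' h x g
        = (\<Sum>t\<le>T. - (dp t + dw t) * a t - dq t * a' t)"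
      unfolding total_payoff_def Let_def sum_subtractf[symmetric]
      by (simp add: T_def dp_def dq_def dw_def a_def a'_def y_def algebra_simps)
    also have "\<bar>\<dots>\<bar> \<le> (\<Sum>t\<le>T. 3 * B * ?D)"
      by (rule order_trans[OF sum_abs sum_mono]) (rule summand)
    also have "\<dots> = K * ?D"
      by (simp add: K_def)
    also have "\<dots> = \<epsilon> + K * c * ?S"
      using K by (simp add: distrib_left)
    finally show "\<bar>total_payoff M C A h x g - total_payoff M C A' h x g\<bar>
        \<le> \<epsilon> + K * c * (\<Sum>t\<le>horizon M. (A t - A' t)\<^sup>2)"
      by (simp add: T_def)
  qed
qed

text \<open>\<open>hderiv_scaled\<close> applies to every price. Per capita demand has to lie in
  \<open>actions M\<close> because the ancillary cost is assumed differentiable in one argument only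
  when the other lies there.\<close>

lemma total_payoff_scaled_costs:
  assumes scaled: "scaled_costs C n Cn" and n: "1 \<le> n"
    and equi: "equicontinuous_derivatives M C"
    and A: "\<And>t. t \<le> horizon M \<Longrightarrow> A t / real n \<in> actions M"
  shows "total_payoff M Cn A h x g = total_payoff M C (\<lambda>t. A t / real n) h x g"
proof -
  have n': "0 < real n"
    using n by simp
  have A0: "0 \<le> A t" if "t \<le> horizon M" for t
    using A[OF that] n' by (simp add: actions_def zero_le_divide_iff)
  note equi = equi[unfolded equicontinuous_derivatives_def]
  note defs = scaled[unfolded scaled_costs_def]
  have "price_p Cn A h t = price_p C (\<lambda>t. A t / real n) h t" if "t \<le> horizon M" for t
    using hderiv_scaled[of "\<lambda>u. primary C u (h ! t)" "real n" "A t"] equi n' A0[OF that] defs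
    by (simp add: price_p_def)
  moreover have "price_q Cn A h t = price_q C (\<lambda>t. A t / real n) h t" if "t \<le> horizon M" for t
    using hderiv_scaled[of "\<lambda>u. ancillary C u (A t / real n) (h ! (t - 1), h ! t)" "real n" "A (t - 1)"]
      equi n' A0[of "t - 1"] A[OF that] that defs
    by (simp add: price_q_def)
  moreover have "price_w Cn A h t = price_w C (\<lambda>t. A t / real n) h t" if "t \<le> horizon M" for t
    using hderiv_scaled[of "\<lambda>u. ancillary0 C u (h ! 0)" "real n" "A 0"]
      hderiv_scaled[of "\<lambda>u. ancillary C (A (t - 1) / real n) u (h ! (t - 1), h ! t)" "real n" "A t"]
      equi n' A0[of t] A0[of 0] A[of "t - 1"] that defs
    by (simp add: price_w_def)
  ultimately show ?thesis
    unfolding total_payoff_def Let_def by (intro sum.cong) auto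
qed

subsection \<open>Strategies given the types of the other consumers\<close>

text \<open>The two rules are compared only along their own trajectories. A history-dependent rule
  and the oblivious strategy derived from it agree in this sense, though not at arbitrary augmented
  states.\<close>

lemma run_cong:
  assumes "\<And>s. s < t \<Longrightarrow> g s (run M x h g s) = g' s (run M x h' g' s)"
    and "take (Suc t) h = take (Suc t) h'"
  shows "run M x h g t = run M x h' g' t"
  using assms
proof (induction t)
  case 0
  then show ?case by simp
next
  case (Suc t)
  have "take (Suc t) h = take (Suc t) h'"
    using arg_cong[OF Suc.prems(2), of "take (Suc t)"] by simp
  then have "run M x h g t = run M x h' g' t"
    using Suc.prems(1) by (intro Suc.IH) auto
  moreover have "h ! Suc t = h' ! Suc t"
    using arg_cong[OF Suc.prems(2), of "\<lambda>l. l ! Suc t"] by simp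
  ultimately show ?case
    using Suc.prems(1)[of t] by (simp add: Let_def)
qed

lemma total_payoff_cong:
  assumes eq: "\<And>t. t \<le> horizon M \<Longrightarrow> g t (run M x h g t) = g' t (run M x h g' t)"
  shows "total_payoff M C A h x g = total_payoff M C A h x g'"
proof -
  have "run M x h g t = run M x h g' t" if "t \<le> horizon M" for t
    using eq that by (intro run_cong) auto
  with eq show ?thesis
    unfolding total_payoff_def Let_def by (intro sum.cong) auto
qed

lemma take_Suc_eq_mono:
  assumes "take (Suc t) h = take (Suc t) h'" "s \<le> t"
  shows "take (Suc s) h = take (Suc s) h'"
  using arg_cong[OF assms(1), of "take (Suc s)"] assms(2) by (simp add: min_absorb2)

lemma run_obl_rule_prefix:
  assumes "take (Suc t) h = take (Suc t) h'"
  shows "run M x h (obl_rule \<nu> x h) t = run M x h' (obl_rule \<nu> x h') t"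
proof (rule run_cong)
  fix s assume "s < t"
  then show "obl_rule \<nu> x h s (run M x h (obl_rule \<nu> x h) s)
      = obl_rule \<nu> x h' s (run M x h' (obl_rule \<nu> x h') s)"
    using take_Suc_eq_mono[OF assms, of s] by (simp add: obl_rule_def)
qed fact

text \<open>Non-anticipation: the others play obliviously, so for given types their empirical
  distribution at stage \<open>t\<close> is determined by the history up to
  \<open>t\<close>.\<close>

lemma hist_rule_prefix:
  assumes "take (Suc t) h = take (Suc t) h'"
  shows "hist_rule M n i \<theta> h \<kappa> \<nu> t = hist_rule M n i \<theta> h' \<kappa> \<nu> t"
  by (simp add: hist_rule_def others_empirical_def fun_eq_iff assms run_obl_rule_prefix[OF assms])

text \<open>The induction is strong because \<open>run_cong\<close> asks for equal actions at all
  earlier stages.\<close>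

lemma run_hist_rule_prefix:
  assumes "take (Suc t) h = take (Suc t) h'"
  shows "run M x h (hist_rule M n i \<theta> h \<kappa> \<nu>) t = run M x h' (hist_rule M n i \<theta> h' \<kappa> \<nu>) t"
  using assms
proof (induction t rule: less_induct)
  case (less t)
  show ?case
  proof (rule run_cong)
    fix s assume "s < t"
    then have "take (Suc s) h = take (Suc s) h'"
      using take_Suc_eq_mono[OF less.prems, of s] by simp
    then show "hist_rule M n i \<theta> h \<kappa> \<nu> s (run M x h (hist_rule M n i \<theta> h \<kappa> \<nu>) s)
        = hist_rule M n i \<theta> h' \<kappa> \<nu> s (run M x h' (hist_rule M n i \<theta> h' \<kappa> \<nu>) s)"
      by (simp add: less.IH[OF \<open>s < t\<close>] hist_rule_prefix[of s h h'])
  qed (rule less.prems)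
qed

lemma set_path_pmf:
  "h \<in> set_pmf (path_pmf M s\<^sub>0 t) \<Longrightarrow> length h = Suc t \<and> h ! 0 = s\<^sub>0"
proof (induction t arbitrary: h)
  case 0
  then show ?case by simp
next
  case (Suc t)
  then show ?case by (auto simp: nth_append)
qed

lemma finite_set_path_pmf: "finite (set_pmf (path_pmf M (s\<^sub>0 :: 's::finite) t))"
proof (rule finite_subset)
  show "set_pmf (path_pmf M s\<^sub>0 t) \<subseteq> {h. set h \<subseteq> UNIV \<and> length h = Suc t}"
    by (auto dest: set_path_pmf)
qed (rule finite_lists_length_eq[OF finite])

lemma hist_rule_in_actions:
  assumes "\<kappa> \<in> hist_strategies M" "t \<le> horizon M" "length h > t" "y \<in> augs M t"
  shows "hist_rule M n i \<theta> h \<kappa> \<nu> t y \<in> actions M"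
  using assms by (simp add: hist_rule_def hist_strategies_def)

text \<open>
  Once the types of the other consumers are fixed, the empirical distribution is a function of the
  history, so a history-dependent strategy acts like an oblivious one.
\<close>
definition induced_obl ::
    "('x, 's) market \<Rightarrow> nat \<Rightarrow> nat \<Rightarrow> (nat \<Rightarrow> 'x) \<Rightarrow> ('x, 's) hist_strategy \<Rightarrow>
     ('x, 's) obl_strategy \<Rightarrow> ('x, 's) obl_strategy" where
  "induced_obl M n i \<theta> \<kappa> \<nu> t x h =
     hist_rule M n i \<theta> h \<kappa> \<nu> t (run M x h (hist_rule M n i \<theta> h \<kappa> \<nu>) t)"

lemma run_hist_rule_in_augs:
  assumes M: "market_model M" and \<kappa>: "\<kappa> \<in> hist_strategies M"
    and t: "t \<le> horizon M" "length h > t"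
  shows "run M x h (hist_rule M n i \<theta> h \<kappa> \<nu>) t \<in> augs M t"
  using assms by (intro run_in_augs hist_rule_in_actions) auto

lemma induced_obl_in_obl_strategies:
  assumes "market_model M" "\<kappa> \<in> hist_strategies M"
  shows "induced_obl M n i \<theta> \<kappa> \<nu> \<in> obl_strategies M"
  using assms run_hist_rule_in_augs[OF assms]
  by (auto simp: obl_strategies_def induced_obl_def intro!: hist_rule_in_actions)

lemma total_payoff_induced_obl:
  "total_payoff M C A h x (hist_rule M n i \<theta> h \<kappa> \<nu>)
     = total_payoff M C A h x (obl_rule (induced_obl M n i \<theta> \<kappa> \<nu>) x h)"
proof (rule total_payoff_cong)
  fix t
  \<comment> \<open>An oblivious strategy is evaluated at the truncated path. Truncating again
    changes nothing, so the prefix lemmas identify what happens at stage \<open>t\<close> on the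
    truncated and on the full path.\<close>
  have *: "take (Suc t) (take (Suc t) h) = take (Suc t) h" by simp
  show "hist_rule M n i \<theta> h \<kappa> \<nu> t (run M x h (hist_rule M n i \<theta> h \<kappa> \<nu>) t)
      = obl_rule (induced_obl M n i \<theta> \<kappa> \<nu>) x h t
          (run M x h (obl_rule (induced_obl M n i \<theta> \<kappa> \<nu>) x h) t)"
    unfolding obl_rule_def induced_obl_def hist_rule_prefix[OF *] run_hist_rule_prefix[OF *] ..
qed

lemma ctype_run: "ctype (snd (run M x h g t)) = x"
  by (cases t) (simp_all add: Let_def)

lemma induced_obl_as_hist: "length h = Suc t \<Longrightarrow> induced_obl M n i \<theta> (as_hist \<nu>) \<nu> t x h = \<nu> t x h"
  by (simp add: induced_obl_def hist_rule_def as_hist_def ctype_run)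

lemma as_hist_in_hist_strategies: "\<nu> \<in> obl_strategies M \<Longrightarrow> as_hist \<nu> \<in> hist_strategies M"
  by (simp add: hist_strategies_def obl_strategies_def as_hist_def)

section \<open>The equilibrium inequality at continuum prices\<close>

lemma obl_value_le_of_DOE:
  assumes "DOE M C \<nu>" "\<nu>' \<in> obl_strategies M"
  shows "obl_value M C x s\<^sub>0 \<nu>' \<nu> \<le> obl_value M C x s\<^sub>0 \<nu> \<nu>"
proof -
  have "ereal (obl_value M C x s\<^sub>0 \<nu>' \<nu>) \<le> (SUP \<nu>'\<in>obl_strategies M. ereal (obl_value M C x s\<^sub>0 \<nu>' \<nu>))"
    using assms(2) by (rule SUP_upper)
  also have "\<dots> = ereal (obl_value M C x s\<^sub>0 \<nu> \<nu>)"
    using assms(1) by (simp add: DOE_def)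
  finally show ?thesis by simp
qed

text \<open>This value mediates between \<open>n_value\<close> and \<open>obl_value\<close>: prices
  are those of the continuum model, but the others' types remain random because
  \<open>\<kappa>\<close> observes their empirical distribution.\<close>

definition limit_value ::
    "('x::finite, 's::finite) market \<Rightarrow> 's costs \<Rightarrow> nat \<Rightarrow> nat \<Rightarrow> 'x \<Rightarrow> 's \<Rightarrow>
     ('x, 's) hist_strategy \<Rightarrow> ('x, 's) obl_strategy \<Rightarrow> real" where
  "limit_value M C n i x s\<^sub>0 \<kappa> \<nu> =
     measure_pmf.expectation
       (pair_pmf (Pi_pmf ({1..n} - {i}) undefined (\<lambda>_. type_dist M s\<^sub>0)) (path_pmf M s\<^sub>0 (horizon M)))
       (\<lambda>(\<theta>, h). total_payoff M C (avg_demand M \<nu> h) h x (hist_rule M n i \<theta> h \<kappa> \<nu>))"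

text \<open>Conditioning on the types first turns \<open>\<kappa>\<close> into a fixed oblivious
  strategy, so the inner expectation over paths is an oblivious value.\<close>

lemma limit_value_eq:
  "limit_value M C n i x s\<^sub>0 \<kappa> \<nu> =
     measure_pmf.expectation (Pi_pmf ({1..n} - {i}) undefined (\<lambda>_. type_dist M s\<^sub>0))
       (\<lambda>\<theta>. obl_value M C x s\<^sub>0 (induced_obl M n i \<theta> \<kappa> \<nu>) \<nu>)"
  unfolding limit_value_def obl_value_def
  by (subst expectation_pair_pmf_finite)
    (auto simp: finite_set_path_pmf total_payoff_induced_obl intro!: finite_set_Pi_pmf)

text \<open>The equilibrium inequality holds for each realization of the types, and therefore on
  average.\<close>

lemma limit_value_le:
  assumes "market_model M" "DOE M C \<nu>" "\<kappa> \<in> hist_strategies M"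
  shows "limit_value M C n i x s\<^sub>0 \<kappa> \<nu> \<le> obl_value M C x s\<^sub>0 \<nu> \<nu>"
proof -
  have "limit_value M C n i x s\<^sub>0 \<kappa> \<nu> \<le>
      measure_pmf.expectation (Pi_pmf ({1..n} - {i}) undefined (\<lambda>_. type_dist M s\<^sub>0))
        (\<lambda>\<theta>. obl_value M C x s\<^sub>0 \<nu> \<nu>)"
    unfolding limit_value_eq
    by (intro expectation_mono_finite finite_set_Pi_pmf obl_value_le_of_DOE[OF assms(2)]
        induced_obl_in_obl_strategies[OF assms(1,3)]) auto
  then show ?thesis by simp
qed

lemma limit_value_as_hist: "limit_value M C n i x s\<^sub>0 (as_hist \<nu>) \<nu> = obl_value M C x s\<^sub>0 \<nu> \<nu>"
proof -
  have "obl_value M C x s\<^sub>0 (induced_obl M n i \<theta> (as_hist \<nu>) \<nu>) \<nu> = obl_value M C x s\<^sub>0 \<nu> \<nu>" for \<theta>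
    unfolding obl_value_def
  proof (intro expectation_cong_pmf total_payoff_cong)
    fix h t assume "h \<in> set_pmf (path_pmf M s\<^sub>0 (horizon M))" "t \<le> horizon M"
    then have "length (take (Suc t) h) = Suc t"
      by (auto dest: set_path_pmf)
    then show "obl_rule (induced_obl M n i \<theta> (as_hist \<nu>) \<nu>) x h t
          (run M x h (obl_rule (induced_obl M n i \<theta> (as_hist \<nu>) \<nu>) x h) t)
        = obl_rule \<nu> x h t (run M x h (obl_rule \<nu> x h) t)"
      by (simp only: obl_rule_def induced_obl_as_hist)
  qed
  then show ?thesis
    by (simp add: limit_value_eq)
qed

subsection \<open>Concentration of demand\<close>

lemma avg_demand_eq_expectation:
  "avg_demand M \<nu> h t =
     measure_pmf.expectation (type_dist M (h ! 0)) (\<lambda>x. \<nu> t x (take (Suc t) h))"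
  unfolding avg_demand_def by (subst integral_measure_pmf[of UNIV]) auto

lemma avg_demand_in_actions:
  assumes "\<nu> \<in> obl_strategies M" "t \<le> horizon M" "length h > t"
  shows "avg_demand M \<nu> h t \<in> actions M"
proof -
  have \<nu>: "0 \<le> \<nu> t x (take (Suc t) h)" "\<nu> t x (take (Suc t) h) \<le> max_action M" for x
    using assms by (auto simp: obl_strategies_def actions_def)
  have "measure_pmf.expectation (type_dist M (h ! 0)) (\<lambda>x. \<nu> t x (take (Suc t) h))
      \<le> measure_pmf.expectation (type_dist M (h ! 0)) (\<lambda>x. max_action M)"
    using \<nu> by (intro expectation_mono_finite) auto
  moreover have "0 \<le> measure_pmf.expectation (type_dist M (h ! 0)) (\<lambda>x. \<nu> t x (take (Suc t) h))"
    using \<nu> by (intro integral_nonneg_AE) auto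
  ultimately show ?thesis
    by (simp add: avg_demand_eq_expectation actions_def)
qed

lemma total_demand_eq:
  "total_demand M n i x \<theta> h \<kappa> \<nu> t =
     induced_obl M n i \<theta> \<kappa> \<nu> t x h + (\<Sum>j\<in>{1..n} - {i}. \<nu> t (\<theta> j) (take (Suc t) h))"
  by (simp add: total_demand_def induced_obl_def Let_def)

lemma induced_obl_in_actions:
  assumes "market_model M" "\<kappa> \<in> hist_strategies M" "t \<le> horizon M" "length h > t"
  shows "induced_obl M n i \<theta> \<kappa> \<nu> t x h \<in> actions M"
  unfolding induced_obl_def using assms
  by (intro hist_rule_in_actions run_hist_rule_in_augs) auto

lemma scaled_total_demand_in_actions:
  assumes M: "market_model M" and \<kappa>: "\<kappa> \<in> hist_strategies M" and \<nu>: "\<nu> \<in> obl_strategies M"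
    and t: "t \<le> horizon M" "length h > t" and n: "i \<in> {1..n}"
  shows "total_demand M n i x \<theta> h \<kappa> \<nu> t / real n \<in> actions M"
proof -
  define B where "B = max_action M"
  let ?S = "\<Sum>j\<in>{1..n} - {i}. \<nu> t (\<theta> j) (take (Suc t) h)"
  have f: "0 \<le> \<nu> t x (take (Suc t) h)" "\<nu> t x (take (Suc t) h) \<le> B" for x
    using \<nu> t by (auto simp: obl_strategies_def actions_def B_def)
  have "0 \<le> ?S"
    using f by (intro sum_nonneg)
  moreover have "?S \<le> real (card ({1..n} - {i})) * B"
    using f by (intro sum_bounded_above)
  then have "?S \<le> n * B - B"
    using n by (simp add: of_nat_diff algebra_simps)
  moreover have "0 \<le> induced_obl M n i \<theta> \<kappa> \<nu> t x h" "induced_obl M n i \<theta> \<kappa> \<nu> t x h \<le> B"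
    using induced_obl_in_actions[OF M \<kappa> t] by (auto simp: actions_def B_def)
  ultimately have "0 \<le> total_demand M n i x \<theta> h \<kappa> \<nu> t" "total_demand M n i x \<theta> h \<kappa> \<nu> t \<le> n * B"
    unfolding total_demand_eq by linarith+
  then show ?thesis
    using n by (simp add: actions_def B_def field_simps)
qed

text \<open>The consumer's own centred action is at most \<open>B\<close> in size, and the others'
  centred actions are i.i.d. with mean zero. As there are \<open>n - 1\<close> others, the two
  contributions add up to \<open>2 * n\<close> times the square of \<open>B\<close>, divided by the
  square of \<open>n\<close>.\<close>

lemma expected_square_demand_deviation:
  assumes M: "market_model M" and \<kappa>: "\<kappa> \<in> hist_strategies M" and \<nu>: "\<nu> \<in> obl_strategies M"
    and t: "t \<le> horizon M" "length h > t" and n: "i \<in> {1..n}"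
  shows "measure_pmf.expectation (Pi_pmf ({1..n} - {i}) d (\<lambda>_. type_dist M (h ! 0)))
      (\<lambda>\<theta>. (total_demand M n i x \<theta> h \<kappa> \<nu> t / real n - avg_demand M \<nu> h t)\<^sup>2)
    \<le> 2 * (max_action M)\<^sup>2 / real n"
proof -
  define B where "B = max_action M"
  define J where "J = {1..n} - {i}"
  define p where "p = type_dist M (h ! 0)"
  define f where "f = (\<lambda>x. \<nu> t x (take (Suc t) h))"
  define \<mu> where "\<mu> = avg_demand M \<nu> h t"
  have J: "finite J" "real (card J) = real n - 1"
    using n by (auto simp: J_def of_nat_diff)
  have n0: "0 < real n"
    using n by simp
  have \<mu>: "\<mu> = measure_pmf.expectation p f"
    by (simp add: \<mu>_def f_def p_def avg_demand_eq_expectation)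
  have \<mu>B: "0 \<le> \<mu>" "\<mu> \<le> B"
    using avg_demand_in_actions[OF \<nu> t] by (auto simp: \<mu>_def actions_def B_def)
  have fB: "0 \<le> f x" "f x \<le> B" for x
    using \<nu> t by (auto simp: obl_strategies_def actions_def B_def f_def)
  let ?P = "Pi_pmf J d (\<lambda>_. p)"
  let ?S = "\<lambda>\<theta>. \<Sum>j\<in>J. f (\<theta> j) - \<mu>"
  have P: "finite (set_pmf ?P)"
    using J by (intro finite_set_Pi_pmf) auto
  have pointwise: "(total_demand M n i x \<theta> h \<kappa> \<nu> t / real n - \<mu>)\<^sup>2 \<le> (2 * B\<^sup>2 + 2 * (?S \<theta>)\<^sup>2) / (real n)\<^sup>2" for \<theta>
  proof -
    define a where "a = induced_obl M n i \<theta> \<kappa> \<nu> t x h - \<mu>"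
    have "\<bar>a\<bar> \<le> B"
      using induced_obl_in_actions[OF M \<kappa> t, of n i \<theta> \<nu> x] \<mu>B by (auto simp: actions_def B_def a_def)
    from power_mono[OF this, of 2] have "a\<^sup>2 \<le> B\<^sup>2" by simp
    \<comment> \<open>The own deviation \<open>a\<close> may depend on \<open>\<theta>\<close>
      through the observed empirical distribution, so it need not be independent of the sum; this
      inequality separates the two.\<close>
    moreover have "(a + ?S \<theta>)\<^sup>2 \<le> 2 * a\<^sup>2 + 2 * (?S \<theta>)\<^sup>2"
      using zero_le_power2[of "a - ?S \<theta>"] by (simp add: power2_sum power2_diff)
    moreover have "total_demand M n i x \<theta> h \<kappa> \<nu> t / real n - \<mu> = (a + ?S \<theta>) / real n"
    proof -
      \<comment> \<open>Of the \<open>n\<close> copies of the mean, one is subtracted in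
        \<open>a\<close> and the others in the sum over \<open>J\<close>.\<close>
      have "real n = real (card J) + 1"
        using J by simp
      then have "total_demand M n i x \<theta> h \<kappa> \<nu> t = a + ?S \<theta> + real n * \<mu>"
        unfolding total_demand_eq J_def[symmetric]
        by (simp add: a_def sum_subtractf f_def algebra_simps)
      then show ?thesis
        using n0 by (simp add: add_divide_distrib)
    qed
    ultimately show ?thesis
      by (simp add: power_divide divide_right_mono)
  qed
  have "measure_pmf.expectation ?P (\<lambda>\<theta>. (total_demand M n i x \<theta> h \<kappa> \<nu> t / real n - \<mu>)\<^sup>2)
      \<le> measure_pmf.expectation ?P (\<lambda>\<theta>. (2 * B\<^sup>2 + 2 * (?S \<theta>)\<^sup>2) / (real n)\<^sup>2)"
    by (intro expectation_mono_finite P pointwise)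
  also have "\<dots> = (2 * B\<^sup>2 + 2 * measure_pmf.expectation ?P (\<lambda>\<theta>. (?S \<theta>)\<^sup>2)) / (real n)\<^sup>2"
    by (simp add: integrable_measure_pmf_finite[OF P])
  also have "\<dots> \<le> (2 * B\<^sup>2 + 2 * (real (card J) * B\<^sup>2)) / (real n)\<^sup>2"
  proof (intro divide_right_mono add_left_mono mult_left_mono second_moment_iid_sum J)
    show "measure_pmf.expectation p (\<lambda>x. f x - \<mu>) = 0"
      by (simp add: \<mu> integrable_measure_pmf_finite)
    show "\<bar>f x - \<mu>\<bar> \<le> B" for x
      using fB[of x] \<mu>B by linarith
  qed auto
  also have "\<dots> = 2 * B\<^sup>2 / real n"
    unfolding J(2) using n0 by (simp add: power2_eq_square field_simps)
  finally show ?thesis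
    by (simp add: B_def J_def p_def \<mu>_def)
qed

text \<open>The constant \<open>c\<close> is fixed before \<open>n\<close> and
  \<open>\<kappa>\<close>. This uniformity allows the deviating strategy to change with
  \<open>n\<close>.\<close>

lemma n_value_approximation:
  fixes M :: "('x::finite, 's::finite) market"
  assumes M: "market_model M" and scaling: "\<forall>n\<ge>1. scaled_costs C n (Cn n)"
    and equi: "equicontinuous_derivatives M C" and bounded: "bounded_derivatives M C"
    and \<nu>: "\<nu> \<in> obl_strategies M" and e: "0 < \<epsilon>"
  obtains c where "\<And>n i x s\<^sub>0 \<kappa>. i \<in> {1..n} \<Longrightarrow> \<kappa> \<in> hist_strategies M \<Longrightarrow>
    \<bar>n_value M (Cn n) n i x s\<^sub>0 \<kappa> \<nu> - limit_value M C n i x s\<^sub>0 \<kappa> \<nu>\<bar> \<le> \<epsilon> + c / real n"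
proof -
  define T where "T = horizon M"
  obtain c where c: "0 \<le> c" and payoff:
    "\<And>A A' h x g. (\<And>t. t \<le> horizon M \<Longrightarrow> A t \<in> actions M) \<Longrightarrow>
      (\<And>t. t \<le> horizon M \<Longrightarrow> A' t \<in> actions M) \<Longrightarrow>
      (\<And>t y. t \<le> horizon M \<Longrightarrow> y \<in> augs M t \<Longrightarrow> g t y \<in> actions M) \<Longrightarrow>
      \<bar>total_payoff M C A h x g - total_payoff M C A' h x g\<bar>
        \<le> \<epsilon> + c * (\<Sum>t\<le>horizon M. (A t - A' t)\<^sup>2)"
    by (rule total_payoff_difference_bound[OF M equi bounded e]) blast
  define c' where "c' = c * ((real T + 1) * (2 * (max_action M)\<^sup>2))"
  show thesis
  proof (rule that)
    fix n i :: nat and x :: 'x and s\<^sub>0 :: 's and \<kappa> :: "('x, 's) hist_strategy"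
    assume i: "i \<in> {1..n}" and \<kappa>: "\<kappa> \<in> hist_strategies M"
    define P where "P = Pi_pmf ({1..n} - {i}) undefined (\<lambda>_. type_dist M s\<^sub>0)"
    define H where "H = path_pmf M s\<^sub>0 T"
    have finP: "finite (set_pmf P)"
      unfolding P_def by (intro finite_set_Pi_pmf) auto
    have finH: "finite (set_pmf H)"
      unfolding H_def by (rule finite_set_path_pmf)
    have fin: "finite (set_pmf (pair_pmf P H))"
      using finP finH by simp
    note int = integrable_measure_pmf_finite[OF finP] integrable_measure_pmf_finite[OF finH]
      integrable_measure_pmf_finite[OF fin]
    define d where "d = (\<lambda>\<theta> h t. (total_demand M n i x \<theta> h \<kappa> \<nu> t / real n - avg_demand M \<nu> h t)\<^sup>2)"
    define F where "F = (\<lambda>\<theta> h. total_payoff M (Cn n) (total_demand M n i x \<theta> h \<kappa> \<nu>) h x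
        (hist_rule M n i \<theta> h \<kappa> \<nu>))"
    define G where "G = (\<lambda>\<theta> h. total_payoff M C (avg_demand M \<nu> h) h x (hist_rule M n i \<theta> h \<kappa> \<nu>))"
    have pointwise: "\<bar>F \<theta> h - G \<theta> h\<bar> \<le> \<epsilon> + c * (\<Sum>t\<le>T. d \<theta> h t)" if "h \<in> set_pmf H" for \<theta> h
    proof -
      have len: "t < length h" if "t \<le> horizon M" for t
        using set_path_pmf \<open>h \<in> set_pmf H\<close> that unfolding H_def T_def by fastforce
      have demand: "total_demand M n i x \<theta> h \<kappa> \<nu> t / real n \<in> actions M" if "t \<le> horizon M" for t
        using scaled_total_demand_in_actions[OF M \<kappa> \<nu> that len[OF that] i] .
      have "F \<theta> h = total_payoff M C (\<lambda>t. total_demand M n i x \<theta> h \<kappa> \<nu> t / real n) h x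
          (hist_rule M n i \<theta> h \<kappa> \<nu>)"
        unfolding F_def using scaling i equi demand by (intro total_payoff_scaled_costs) auto
      then show ?thesis
        unfolding G_def d_def T_def
        using payoff[OF demand avg_demand_in_actions[OF \<nu> _ len]
            hist_rule_in_actions[OF \<kappa> _ len]] by simp
    qed
    have "n_value M (Cn n) n i x s\<^sub>0 \<kappa> \<nu> - limit_value M C n i x s\<^sub>0 \<kappa> \<nu>
        = measure_pmf.expectation (pair_pmf P H) (\<lambda>(\<theta>, h). F \<theta> h - G \<theta> h)"
      unfolding n_value_def limit_value_def F_def G_def P_def H_def T_def case_prod_unfold
      by (rule Bochner_Integration.integral_diff[symmetric])
        (use int in \<open>simp_all add: P_def H_def T_def\<close>)
    also have "\<bar>\<dots>\<bar> \<le> measure_pmf.expectation (pair_pmf P H) (\<lambda>(\<theta>, h). \<bar>F \<theta> h - G \<theta> h\<bar>)"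
      using integral_abs_bound[of "pair_pmf P H" "\<lambda>(\<theta>, h). F \<theta> h - G \<theta> h"]
      by (simp add: case_prod_unfold)
    also have "\<dots> \<le> measure_pmf.expectation (pair_pmf P H) (\<lambda>(\<theta>, h). \<epsilon> + c * (\<Sum>t\<le>T. d \<theta> h t))"
      using fin by (intro expectation_mono_finite) (auto intro: pointwise)
    \<comment> \<open>The order is exchanged so that the types are averaged for a fixed path, which
      is the setting of the second moment bound.\<close>
    also have "\<dots> = measure_pmf.expectation (pair_pmf H P) (\<lambda>(h, \<theta>). \<epsilon> + c * (\<Sum>t\<le>T. d \<theta> h t))"
      by (subst pair_commute_pmf) (simp add: case_prod_unfold)
    also have "\<dots> = measure_pmf.expectation H
        (\<lambda>h. \<epsilon> + c * (\<Sum>t\<le>T. measure_pmf.expectation P (\<lambda>\<theta>. d \<theta> h t)))"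
      by (simp add: expectation_pair_pmf_finite[OF finH finP] int)
    also have "\<dots> \<le> measure_pmf.expectation H
        (\<lambda>h. \<epsilon> + c * (\<Sum>t\<le>T. 2 * (max_action M)\<^sup>2 / real n))"
    proof (intro expectation_mono_finite finH add_left_mono mult_left_mono sum_mono c)
      fix h t assume h: "h \<in> set_pmf H" and t: "t \<in> {..T}"
      \<comment> \<open>Paths start at the given initial state, so \<open>P\<close> draws types from
        the same law that defines the average demand along \<open>h\<close>.\<close>
      have "h ! 0 = s\<^sub>0" "t < length h"
        using set_path_pmf[of h M s\<^sub>0 T] h t by (auto simp: H_def)
      then show "measure_pmf.expectation P (\<lambda>\<theta>. d \<theta> h t) \<le> 2 * (max_action M)\<^sup>2 / real n"
        using expected_square_demand_deviation[OF M \<kappa> \<nu> _ _ i, of t h undefined x] t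
        by (simp add: P_def d_def T_def)
    qed
    also have "\<dots> = \<epsilon> + c' / real n"
      by (simp add: c'_def)
    finally show "\<bar>n_value M (Cn n) n i x s\<^sub>0 \<kappa> \<nu> - limit_value M C n i x s\<^sub>0 \<kappa> \<nu>\<bar> \<le> \<epsilon> + c' / real n" .
  qed
qed

theorem theorem1:
  fixes M :: "('x::finite, 's::finite) market"
    and C :: "'s costs"
    and Cn :: "nat \<Rightarrow> 's costs"
    and \<nu> :: "('x, 's) obl_strategy"
  assumes "market_model M"
    and "cost_functions C"
    and scaling: "\<forall>n\<ge>1. scaled_costs C n (Cn n)"
    and regularity1: "equicontinuous_derivatives M C"
    and regularity2: "bounded_derivatives M C"
    and regularity3: "regular_utility M"
    and "DOE M C \<nu>"
  shows "AME M Cn \<nu>"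
  unfolding AME_def
proof (intro allI impI)
  fix i :: nat and s\<^sub>0 :: 's and x :: 'x and \<kappa> :: "nat \<Rightarrow> ('x, 's) hist_strategy"
  assume i: "1 \<le> i" and \<kappa>: "\<forall>n. \<kappa> n \<in> hist_strategies M"
  let ?gap = "\<lambda>n. n_value M (Cn n) n i x s\<^sub>0 (\<kappa> n) \<nu> - n_value M (Cn n) n i x s\<^sub>0 (as_hist \<nu>) \<nu>"
  have \<nu>: "\<nu> \<in> obl_strategies M"
    using \<open>DOE M C \<nu>\<close> by (simp add: DOE_def)
  have "limsup (\<lambda>n. ereal (?gap n)) \<le> 0 + ereal \<epsilon>" if "0 < \<epsilon>" for \<epsilon>
  proof -
    \<comment> \<open>Passing to continuum prices costs \<open>\<epsilon> / 3 + c / n\<close> once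
      for the deviation and once for \<open>\<nu>\<close>; the two terms \<open>c / n\<close>
      together use up the last third for large \<open>n\<close>.\<close>
    have "0 < \<epsilon> / 3"
      using that by simp
    then obtain c where c: "\<And>n i x s\<^sub>0 \<kappa>. i \<in> {1..n} \<Longrightarrow> \<kappa> \<in> hist_strategies M \<Longrightarrow>
        \<bar>n_value M (Cn n) n i x s\<^sub>0 \<kappa> \<nu> - limit_value M C n i x s\<^sub>0 \<kappa> \<nu>\<bar> \<le> \<epsilon> / 3 + c / real n"
      using n_value_approximation[OF \<open>market_model M\<close> scaling regularity1 regularity2 \<nu>] by blast
    have "(\<lambda>n. 2 * (c / real n)) \<longlonglongrightarrow> 0"
      by real_asymp
    then have "\<forall>\<^sub>F n in sequentially. 2 * (c / real n) < \<epsilon> / 3"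
      using \<open>0 < \<epsilon> / 3\<close> by (rule order_tendstoD)
    then have "\<forall>\<^sub>F n in sequentially. ereal (?gap n) \<le> ereal \<epsilon>"
      \<comment> \<open>The approximation applies only once consumer \<open>i\<close> takes
        part.\<close>
      using eventually_ge_at_top[of i]
    proof eventually_elim
      case (elim n)
      then have n: "i \<in> {1..n}"
        using i by simp
      have "limit_value M C n i x s\<^sub>0 (\<kappa> n) \<nu> \<le> obl_value M C x s\<^sub>0 \<nu> \<nu>"
        using limit_value_le \<open>market_model M\<close> \<open>DOE M C \<nu>\<close> \<kappa> by blast
      then have "limit_value M C n i x s\<^sub>0 (\<kappa> n) \<nu> \<le> limit_value M C n i x s\<^sub>0 (as_hist \<nu>) \<nu>"
        by (simp add: limit_value_as_hist)
      moreover note c[OF n spec[OF \<kappa>, of n], of x s\<^sub>0]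
        c[OF n as_hist_in_hist_strategies[OF \<nu>], of x s\<^sub>0] elim(1)
      ultimately have "?gap n \<le> \<epsilon>"
        by linarith
      then show ?case by simp
    qed
    then show ?thesis
      using Limsup_bounded[of "\<lambda>n. ereal (?gap n)" "ereal \<epsilon>" sequentially] by simp
  qed
  then show "limsup (\<lambda>n. ereal (?gap n)) \<le> 0"
    by (rule ereal_le_epsilon2)
qed

end
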